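(* Let $M$ be a $\delta$-hyperbolic graph of bounded degree. Then there exist an order $T$ on $M$ and a constant $C$ such that for all $k\ge 1$ $$\operatorname{OR}_{M,T}(k)\le C.$$
   Context: All orders are total orders. Let $(M,d)$ be a metric space. For a finite subset $X\subset M$, $l_{\mathrm{opt}}(X)$ denotes the minimal length of a path visiting all points of $X$, i.e. the minimum of $\sum_{i=1}^{m-1} d(y_i,y_{i+1})$ over all enumerations $y_1,\dots,y_m$ of $X$. If $T$ is an order on $M$ and $x_1<_T\dots<_T x_m$ are the points of $X$, put $l_T(X)=\sum_{i=1}^{m-1} d(x_i,x_{i+1})$. If $M$ has at least two points, then for $k\ge 1$ $$\operatorname{OR}_{M,T}(k)=\sup_{X\subset M,\ 2\le \#X\le k+1}\frac{l_T(X)}{l_{\mathrm{opt}}(X)};$$ if $M$ is a single point, $\operatorname{OR}_{M,T}(k)=1$ for all $k\ge1$. Graphs are connected, edges have length $1$, and the graph $M$ is regarded as a geodesic metric space with its edges included. A metric space is $\delta$-hyperbolic ($\delta\ge 0$) if for any four points $X_1,X_2,X_3,X_4$ the difference between the largest and the middle one of the three numbers $d(X_1,X_2)+d(X_3,X_4)$, $d(X_1,X_3)+d(X_2,X_4)$, $d(X_1,X_4)+d(X_2,X_3)$ is at most $\delta$. Bounded degree means that the degrees of the vertices are uniformly bounded. *)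

theory Defs
  imports
    "HOL-Analysis.Analysis"
    "HOL-Combinatorics.Multiset_Permutations"
    "Graph_Theory.Graph_Theory"
begin

section \<open>Orders and travelling along them\<close>

definition path_length :: "('a \<Rightarrow> 'a \<Rightarrow> real) \<Rightarrow> 'a list \<Rightarrow> real" where
  "path_length d xs = (\<Sum>i<length xs - 1. d (xs ! i) (xs ! Suc i))"

definition l_opt :: "('a \<Rightarrow> 'a \<Rightarrow> real) \<Rightarrow> 'a set \<Rightarrow> real" where
  "l_opt d X = Min (path_length d ` permutations_of_set X)"

text \<open>The relation \<open>T\<close> is the non-strict order; the description is unique by
  \<open>order_enum_unique\<close> below.\<close>

definition order_enum :: "'a rel \<Rightarrow> 'a set \<Rightarrow> 'a list" where
  "order_enum T X =
    (THE xs. xs \<in> permutations_of_set X \<and> sorted_wrt (\<lambda>x y. (x, y) \<in> T) xs)"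

definition l_ord :: "('a \<Rightarrow> 'a \<Rightarrow> real) \<Rightarrow> 'a rel \<Rightarrow> 'a set \<Rightarrow> real" where
  "l_ord d T X = path_length d (order_enum T X)"

text \<open>The supremum is taken in the extended reals, since it may be infinite.\<close>

definition OR :: "'a set \<Rightarrow> ('a \<Rightarrow> 'a \<Rightarrow> real) \<Rightarrow> 'a rel \<Rightarrow> nat \<Rightarrow> ereal" where
  "OR M d T k =
    (if is_singleton M then 1
     else (SUP X \<in> {X. X \<subseteq> M \<and> 2 \<le> card X \<and> card X \<le> k + 1}.
             ereal (l_ord d T X / l_opt d X)))"

lemma order_enum_unique:
  assumes T: "linear_order_on M T" and "finite X" "X \<subseteq> M"
  shows "\<exists>!xs. xs \<in> permutations_of_set X \<and> sorted_wrt (\<lambda>x y. (x, y) \<in> T) xs"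
proof -
  have tr: "trans T" and an: "antisym T" and to: "total_on M T" and re: "refl_on M T"
    using T by (auto simp: linear_order_on_def partial_order_on_def preorder_on_def)
  have min: "\<exists>m\<in>F. \<forall>x\<in>F. (m, x) \<in> T" if "finite F" "F \<noteq> {}" "F \<subseteq> M" for F
    using that
  proof (induction rule: finite_ne_induct)
    case (singleton x)
    then show ?case using re by (auto simp: refl_on_def)
  next
    case (insert x F)
    then obtain m where m: "m \<in> F" "\<forall>x\<in>F. (m, x) \<in> T" by auto
    have "(x, m) \<in> T \<or> (m, x) \<in> T"
      using insert.prems m(1) to re insert.hyps by (cases "x = m") (auto simp: total_on_def refl_on_def)
    moreover have "(x, x) \<in> T" using insert.prems re by (auto simp: refl_on_def)
    ultimately show ?case using m tr by (auto dest: transD)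
  qed
  let ?P = "\<lambda>X xs. distinct xs \<and> set xs = X \<and> sorted_wrt (\<lambda>x y. (x, y) \<in> T) xs"
  have "\<exists>!xs. ?P X xs"
    using \<open>finite X\<close> \<open>X \<subseteq> M\<close>
  proof (induction "card X" arbitrary: X)
    case 0
    then show ?case by auto
  next
    case (Suc n)
    have "X \<noteq> {}" using Suc.hyps by auto
    then obtain m where m: "m \<in> X" "\<And>x. x \<in> X \<Longrightarrow> (m, x) \<in> T"
      using min[of X] Suc.prems by blast
    have "n = card (X - {m})" using Suc.hyps(2) m(1) Suc.prems(1) by simp
    then have "\<exists>!xs. ?P (X - {m}) xs"
      by (rule Suc.hyps(1)) (use Suc.prems in auto)
    then obtain xs where xs: "?P (X - {m}) xs" and
      u: "\<forall>ys. ?P (X - {m}) ys \<longrightarrow> ys = xs" by (rule ex1E)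
    show ?case
    proof (rule ex1I[of _ "m # xs"])
      show "?P X (m # xs)" using xs m(1) by (auto intro: m(2))
    next
      fix ys assume ys: "?P X ys"
      then obtain y zs where yz: "ys = y # zs" using m(1) by (cases ys) auto
      have "y = m"
      proof (rule ccontr)
        assume "y \<noteq> m"
        then have "(y, m) \<in> T" "(m, y) \<in> T" using ys yz m(1) m(2)[of y] by auto
        then show False using an \<open>y \<noteq> m\<close> by (auto dest: antisymD)
      qed
      then have "?P (X - {m}) zs" using ys yz by auto
      then have "zs = xs" by (rule u[rule_format])
      then show "ys = m # xs" using yz \<open>y = m\<close> by simp
    qed
  qed
  then show ?thesis
    by (simp add: permutations_of_set_def conj_ac)
qed


section \<open>Hyperbolicity\<close>

definition hyperbolic :: "real \<Rightarrow> 'a set \<Rightarrow> ('a \<Rightarrow> 'a \<Rightarrow> real) \<Rightarrow> bool" where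
  "hyperbolic \<delta> M d \<longleftrightarrow> \<delta> \<ge> 0 \<and>
    (\<forall>x\<^sub>1\<in>M. \<forall>x\<^sub>2\<in>M. \<forall>x\<^sub>3\<in>M. \<forall>x\<^sub>4\<in>M.
       let S = sort [d x\<^sub>1 x\<^sub>2 + d x\<^sub>3 x\<^sub>4, d x\<^sub>1 x\<^sub>3 + d x\<^sub>2 x\<^sub>4, d x\<^sub>1 x\<^sub>4 + d x\<^sub>2 x\<^sub>3]
       in S ! 2 - S ! 1 \<le> \<delta>)"


section \<open>Graphs as metric spaces\<close>

text \<open>
  An undirected graph (loops and multiple edges allowed) is given by a \<open>pre_digraph\<close>
  in which every edge is represented by a single arc. The direction of the arc only
  serves to parametrise the edge by the unit interval.
  Each edge at \<open>v\<close> contributes 1 to the degree, each loop contributes 2.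
\<close>

definition bounded_degree :: "('v, 'e) pre_digraph \<Rightarrow> bool" where
  "bounded_degree G \<longleftrightarrow>
    (\<exists>D. \<forall>v\<in>verts G. finite (in_arcs G v) \<and> finite (out_arcs G v) \<and>
       in_degree G v + out_degree G v \<le> D)"

datatype ('v, 'e) graph_point = Vertex 'v | Inner 'e real

definition graph_points :: "('v, 'e) pre_digraph \<Rightarrow> ('v, 'e) graph_point set" where
  "graph_points G = Vertex ` verts G \<union> {Inner e t | e t. e \<in> arcs G \<and> 0 < t \<and> t < 1}"

text \<open>The point at parameter \<open>t \<in> [0,1]\<close> of the edge \<open>e\<close>.\<close>

definition edge_point :: "('v, 'e) pre_digraph \<Rightarrow> 'e \<Rightarrow> real \<Rightarrow> ('v, 'e) graph_point" where
  "edge_point G e t =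
    (if t = 0 then Vertex (tail G e) else if t = 1 then Vertex (head G e) else Inner e t)"

text \<open>\<open>graph_path G p q l\<close>: there is a path of length \<open>l\<close> from \<open>p\<close> to \<open>q\<close> that
  is a finite concatenation of segments, each of them contained in a single closed edge.\<close>

inductive graph_path ::
  "('v, 'e) pre_digraph \<Rightarrow> ('v, 'e) graph_point \<Rightarrow> ('v, 'e) graph_point \<Rightarrow> real \<Rightarrow> bool"
  for G where
  refl: "p \<in> graph_points G \<Longrightarrow> graph_path G p p 0"
| step: "e \<in> arcs G \<Longrightarrow> s \<in> {0..1} \<Longrightarrow> t \<in> {0..1} \<Longrightarrow> graph_path G (edge_point G e t) q l
    \<Longrightarrow> graph_path G (edge_point G e s) q (\<bar>s - t\<bar> + l)"

text \<open>The length metric; the value off the carrier is irrelevant.\<close>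

definition graph_dist ::
  "('v, 'e) pre_digraph \<Rightarrow> ('v, 'e) graph_point \<Rightarrow> ('v, 'e) graph_point \<Rightarrow> real" where
  "graph_dist G p q =
    (if p \<in> graph_points G \<and> q \<in> graph_points G then Inf {l. graph_path G p q l} else 0)"

lemma graph_path_nonneg: "graph_path G p q l \<Longrightarrow> 0 \<le> l"
  by (induction rule: graph_path.induct) auto

lemma graph_path_trans:
  "graph_path G p q l \<Longrightarrow> graph_path G q r m \<Longrightarrow> graph_path G p r (l + m)"
  by (induction rule: graph_path.induct) (auto simp: add.assoc intro: graph_path.step)

lemma graph_path_Lipschitz:
  assumes "\<And>e s t. e \<in> arcs G \<Longrightarrow> s \<in> {0..1} \<Longrightarrow> t \<in> {0..1} \<Longrightarrow>
      \<bar>f (edge_point G e s) - f (edge_point G e t)\<bar> \<le> \<bar>s - t\<bar>"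
  shows "graph_path G p q l \<Longrightarrow> \<bar>f p - f q\<bar> \<le> (l::real)"
proof (induction rule: graph_path.induct)
  case (step e s t q l)
  with assms[of e s t] show ?case by linarith
qed simp

context wf_digraph
begin

lemma edge_point_in [simp]: "e \<in> arcs G \<Longrightarrow> t \<in> {0..1} \<Longrightarrow> edge_point G e t \<in> graph_points G"
  by (auto simp: edge_point_def graph_points_def)

lemma graph_path_edge:
  "e \<in> arcs G \<Longrightarrow> s \<in> {0..1} \<Longrightarrow> t \<in> {0..1} \<Longrightarrow>
    graph_path G (edge_point G e s) (edge_point G e t) \<bar>s - t\<bar>"
  using graph_path.step[of e G s t "edge_point G e t" 0] graph_path.refl[of "edge_point G e t" G]
  by simp

lemma graph_path_sym: "graph_path G p q l \<Longrightarrow> graph_path G q p l"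
proof (induction rule: graph_path.induct)
  case (step e s t q l)
  then have "graph_path G q (edge_point G e s) (l + \<bar>t - s\<bar>)"
    by (intro graph_path_trans[of G q "edge_point G e t"] graph_path_edge) auto
  then show ?case by (simp add: add.commute abs_minus_commute)
qed (rule graph_path.refl)

lemma graph_path_exists:
  assumes conn: "Digraph_Component.connected G"
    and "p \<in> graph_points G" "q \<in> graph_points G"
  shows "\<exists>l. graph_path G p q l"
proof -
  have 1: "\<exists>v l. v \<in> verts G \<and> graph_path G p (Vertex v) l" if "p \<in> graph_points G" for p
    using that
  proof (cases p)
    case (Inner e t)
    then have "e \<in> arcs G" "0 < t" "t < 1" using that by (auto simp: graph_points_def)
    with graph_path_edge[of e t 0] Inner show ?thesis
      by (auto simp: edge_point_def intro!: exI[of _ "tail G e"])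
  next
    case (Vertex v)
    then have "v \<in> verts G" using that by (auto simp: graph_points_def)
    then show ?thesis using Vertex graph_path.refl[OF that] by blast
  qed
  have 2: "\<exists>l. graph_path G (Vertex u) (Vertex v) l" if "u \<in> verts G" "v \<in> verts G" for u v
  proof -
    have "(u, v) \<in> rtrancl_on (verts G) ((arcs_ends G)\<^sup>s)"
      using conn that by (simp add: connected_conv)
    then show ?thesis
    proof (induction rule: rtrancl_on_induct)
      case base
      then have "Vertex u \<in> graph_points G" by (simp add: graph_points_def)
      then show ?case using graph_path.refl by blast
    next
      case (step y z)
      then obtain l where l: "graph_path G (Vertex u) (Vertex y) l" by auto
      obtain e where e: "e \<in> arcs G"
        "(tail G e = y \<and> head G e = z) \<or> (tail G e = z \<and> head G e = y)"
        using step by (auto simp: symcl_def arcs_ends_conv)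
      have "\<exists>m. graph_path G (Vertex y) (Vertex z) m"
        using e graph_path_edge[of e 0 1] graph_path_edge[of e 1 0]
        by (auto simp: edge_point_def)
      then show ?case using l by (blast intro: graph_path_trans)
    qed
  qed
  show ?thesis
    using 1[OF assms(2)] 1[OF assms(3)] 2 graph_path_trans graph_path_sym by metis
qed

lemma graph_dist_separates:
  assumes conn: "Digraph_Component.connected G"
    and pq: "p \<in> graph_points G" "q \<in> graph_points G" "p \<noteq> q"
  shows "0 < graph_dist G p q"
proof -
  have "\<exists>f. (\<forall>e s t. e \<in> arcs G \<longrightarrow> s \<in> {0..1} \<longrightarrow> t \<in> {0..1} \<longrightarrow>
      \<bar>f (edge_point G e s) - f (edge_point G e t)\<bar> \<le> \<bar>s - t\<bar>) \<and> f p = 0 \<and> f q > (0::real)"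
  proof (cases p)
    case (Vertex v)
    define f :: "('a, 'b) graph_point \<Rightarrow> real" where
      "f x = (case x of Vertex w \<Rightarrow> if w = v then 0 else 1/2
        | Inner e s \<Rightarrow> min (1/2) (min (if tail G e = v then s else 1/2)
                                     (if head G e = v then 1 - s else 1/2)))" for x
    have "f (edge_point G e s) = min (1/2) (min (if tail G e = v then s else 1/2)
                                     (if head G e = v then 1 - s else 1/2))"
      if "s \<in> {0..1}" for e s
      using that by (auto simp: f_def edge_point_def)
    then have "\<bar>f (edge_point G e s) - f (edge_point G e t)\<bar> \<le> \<bar>s - t\<bar>"
      if "s \<in> {0..1}" "t \<in> {0..1}" for e s t
      using that by auto
    moreover have "f p = 0" using Vertex by (simp add: f_def)
    moreover have "f q > 0" using Vertex pq by (cases q) (auto simp: f_def graph_points_def)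
    ultimately show ?thesis by blast
  next
    case (Inner e0 t0)
    then have t0: "0 < t0" "t0 < 1" using pq by (auto simp: graph_points_def)
    define r where "r = min t0 (1 - t0)"
    define f :: "('a, 'b) graph_point \<Rightarrow> real" where
      "f x = (case x of Vertex w \<Rightarrow> r
        | Inner e s \<Rightarrow> if e = e0 then min r \<bar>s - t0\<bar> else r)" for x
    have "f (edge_point G e s) = (if e = e0 then min r \<bar>s - t0\<bar> else r)"
      if "s \<in> {0..1}" for e s
      using that t0 by (auto simp: f_def edge_point_def r_def)
    then have "\<bar>f (edge_point G e s) - f (edge_point G e t)\<bar> \<le> \<bar>s - t\<bar>"
      if "s \<in> {0..1}" "t \<in> {0..1}" for e s t
      using that by (auto simp: min_def abs_if)
    moreover have "f p = 0" using Inner t0 by (simp add: f_def r_def)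
    moreover have "r > 0" using t0 by (simp add: r_def)
    then have "f q > 0" using Inner pq by (cases q) (auto simp: f_def)
    ultimately show ?thesis by blast
  qed
  then obtain f :: "('a, 'b) graph_point \<Rightarrow> real"
    where f: "\<And>l. graph_path G p q l \<Longrightarrow> \<bar>f p - f q\<bar> \<le> l" "f p = 0" "f q > 0"
    using graph_path_Lipschitz by metis
  have "f q \<le> Inf {l. graph_path G p q l}"
    using graph_path_exists[OF conn pq(1,2)] f by (intro cInf_greatest) force+
  then show ?thesis using f pq by (simp add: graph_dist_def)
qed

theorem Metric_space_graph:
  assumes conn: "Digraph_Component.connected G"
  shows "Metric_space (graph_points G) (graph_dist G)"
proof
  have bdd: "bdd_below {l. graph_path G p q l}" for p q
    by (auto intro: bdd_belowI graph_path_nonneg)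
  show nn: "0 \<le> graph_dist G x y" for x y
    using graph_path_exists[OF conn, of x y]
    by (auto simp: graph_dist_def intro!: cInf_greatest intro: graph_path_nonneg)
  show "graph_dist G x y = graph_dist G y x" for x y
    using graph_path_sym by (auto simp: graph_dist_def intro!: arg_cong[of _ _ Inf])
  fix x y z assume x: "x \<in> graph_points G" and y: "y \<in> graph_points G"
  have "graph_dist G x x \<le> 0"
    using x by (auto simp: graph_dist_def intro!: cInf_lower bdd graph_path.refl)
  then show "graph_dist G x y = 0 \<longleftrightarrow> x = y"
    using graph_dist_separates[OF conn x y] nn[of x x] by force
  assume z: "z \<in> graph_points G"
  have "graph_dist G x z \<le> l + m" if "graph_path G x y l" "graph_path G y z m" for l m
    using x z that by (auto simp: graph_dist_def intro!: cInf_lower bdd graph_path_trans)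
  then have "graph_dist G x z - m \<le> Inf {l. graph_path G x y l}" if "graph_path G y z m" for m
    using that graph_path_exists[OF conn x y] by (intro cInf_greatest) (auto simp: diff_le_eq)
  then have "graph_dist G x z - graph_dist G x y \<le> m" if "graph_path G y z m" for m
    using that x y by (fastforce simp: graph_dist_def[of G x y])
  then have "graph_dist G x z - graph_dist G x y \<le> Inf {m. graph_path G y z m}"
    using graph_path_exists[OF conn y z] by (intro cInf_greatest) auto
  then have "graph_dist G x z - graph_dist G x y \<le> graph_dist G y z"
    using y z by (simp add: graph_dist_def[of G y z])
  then show "graph_dist G x z \<le> graph_dist G x y + graph_dist G y z" by simp
qed

end

end

theory Submission
  imports Defs
begin

text \<open>
  Order the vertices hierarchically along a breadth-first search tree, so that the descendants of
  every tree vertex form an interval. Up to additive constants a distance \<open>d x y\<close> counts the levels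
  above the Gromov product of \<open>x\<close> and \<open>y\<close> on the two branches. At level \<open>n\<close> the
  ordered tour can jump at most twice per ancestor at level \<open>n\<close>. By bounded degree, a
  fixed proportion of these ancestors is far apart, and a chain estimate for the visual
  quasi-metric shows that any tour pays a definite amount at levels near \<open>n\<close> for passing from
  one of them to another. Summing over \<open>n\<close> compares the two tours. Inside the edges, a set
  with a tour of length \<open>L\<close> meets \<open>O(1 + L)\<close> half-edges, each of which is traversed monotonically.
\<close>

section \<open>Chains and separated sets\<close>

text \<open>The obstacle at a fixed level is drift: a tour may pass between descendants of far apart
  ancestors by many short steps whose Gromov products all exceed \<open>n\<close>, so it is not
  enough to charge level \<open>n\<close> for the steps that reach down to it. Each step therefore
  also pays at all lower levels, with a weight that decays geometrically below its Gromov product,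
  and its total payment is at most a multiple of its length. The rate of decay is tied to \<delta>:
  an error \<delta> in the Gromov product must not change the visual quasi-metric by more than a
  factor 2, for which sums along chains of any length still control the distance of the ends. The
  other obstacle is additive errors. On the vertices they are harmless, since distinct vertices have
  distance at least 1. Inside the edges a set can be arbitrarily small, so tours shorter than 1 are
  estimated cell by cell, using only that the number of cells is bounded.\<close>

lemma chain_inequality:
  fixes \<rho> :: "nat \<Rightarrow> nat \<Rightarrow> real"
  assumes zero: "\<And>i. \<rho> i i = 0" and nonneg: "\<And>i j. 0 \<le> \<rho> i j"
    and quasi: "\<And>i j k l. i \<le> j \<Longrightarrow> j \<le> k \<Longrightarrow> k \<le> l \<Longrightarrow> l \<le> m \<Longrightarrow>
      \<rho> i l \<le> 2 * max (\<rho> i j) (max (\<rho> j k) (\<rho> k l))"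
    and "i \<le> j" "j \<le> m"
  shows "\<rho> i j \<le> 2 * (\<Sum>k=i..<j. \<rho> k (Suc k))"
  using \<open>i \<le> j\<close> \<open>j \<le> m\<close>
proof (induction "j - i" arbitrary: i j rule: less_induct)
  case less
  show ?case
  proof (cases "i = j")
    case True
    then show ?thesis by (simp add: zero)
  next
    case False
    define S where "S a b = (\<Sum>k=a..<b. \<rho> k (Suc k))" for a b
    have S_split: "S a c = S a b + S b c" if "a \<le> b" "b \<le> c" for a b c
      unfolding S_def using that by (simp add: sum.atLeastLessThan_concat)
    have S_nonneg: "0 \<le> S a b" for a b
      by (simp add: S_def sum_nonneg nonneg)
    \<comment> \<open>Frink's argument: \<open>b\<close> is the last index up to which the chain
      carries at most half of the total \<open>S i j\<close>. The piece after the step from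
      \<open>b\<close> then carries at most half as well. By induction \<open>\<rho>\<close> is at
      most the total on both pieces, as it is on the step itself, and the three-term
      quasi-inequality restores the factor 2.\<close>
    define A where "A = {b. i \<le> b \<and> b < j \<and> 2 * S i b \<le> S i j}"
    have "finite A" by (rule finite_subset[of _ "{..<j}"]) (auto simp: A_def)
    moreover have "i \<in> A"
      using False less.prems S_nonneg[of i j] by (auto simp: A_def S_def)
    ultimately have MA: "Max A \<in> A" and Mx: "\<And>b. b \<in> A \<Longrightarrow> b \<le> Max A"
      by (auto intro: Max_in)
    define b where "b = Max A"
    have b: "i \<le> b" "b < j" "2 * S i b \<le> S i j" using MA by (auto simp: A_def b_def)
    have c: "2 * S (Suc b) j \<le> S i j"
    proof (cases "Suc b = j")
      case True
      then show ?thesis using S_nonneg[of i j] by (simp add: S_def)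
    next
      case False
      then have "Suc b \<notin> A" using Mx[of "Suc b"] by (auto simp: b_def)
      then have "S i j < 2 * S i (Suc b)" using False b by (auto simp: A_def)
      then show ?thesis using S_split[of i "Suc b" j] b by linarith
    qed
    have "\<rho> i b \<le> 2 * S i b" unfolding S_def
      using b less.prems by (intro less.hyps) auto
    moreover have "\<rho> (Suc b) j \<le> 2 * S (Suc b) j" unfolding S_def
      using b less.prems by (intro less.hyps) auto
    moreover have "\<rho> b (Suc b) \<le> S i j"
      using S_split[of i b j] S_split[of b "Suc b" j] b S_nonneg[of i b] S_nonneg[of "Suc b" j]
      by (simp add: S_def)
    moreover have "\<rho> i j \<le> 2 * max (\<rho> i b) (max (\<rho> b (Suc b)) (\<rho> (Suc b) j))"
      using b less.prems by (intro quasi) auto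
    ultimately have "\<rho> i j \<le> 2 * S i j" using b c by linarith
    then show ?thesis by (simp add: S_def)
  qed
qed

text \<open>Neighbouring elements of \<open>I\<close> bound disjoint intervals, each carrying at
  least \<open>c\<close>. The subtraction is taken in the reals, so for empty \<open>I\<close> the
  left-hand side is \<open>-c\<close>.\<close>

lemma sum_ge_card_separated:
  fixes f :: "nat \<Rightarrow> real"
  assumes "finite I" "\<And>k. 0 \<le> f k" "0 \<le> c"
    and "\<And>i j. i \<in> I \<Longrightarrow> j \<in> I \<Longrightarrow> i < j \<Longrightarrow> c \<le> sum f {i..<j}"
    and "\<And>i. i \<in> I \<Longrightarrow> i \<le> m"
  shows "c * (real (card I) - 1) \<le> sum f {..<m}"
  using assms(1,4,5)
proof (induction arbitrary: m rule: finite_linorder_max_induct)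
  case empty
  have "0 \<le> sum f {..<m}" using assms(2) by (simp add: sum_nonneg)
  then show ?case using assms(3) by simp
next
  case (insert b A)
  have "sum f {..<b} \<le> sum f {..<m}"
    using insert.prems(2)[of b] assms(2) by (intro sum_mono2) auto
  moreover have "c * (real (card (insert b A)) - 1) \<le> sum f {..<b}"
  proof (cases "A = {}")
    case True
    then show ?thesis using assms(2) by (simp add: sum_nonneg)
  next
    case False
    let ?a = "Max A"
    have a: "?a \<in> A" "?a < b" using False insert.hyps by auto
    have "c * (real (card A) - 1) \<le> sum f {..<?a}"
      using insert.hyps insert.prems by (intro insert.IH) auto
    moreover have "c \<le> sum f {?a..<b}" using a insert.prems by auto
    moreover have "sum f {..<b} = sum f {..<?a} + sum f {?a..<b}"
      using a sum.atLeastLessThan_concat[of 0 ?a b f] by (simp add: atLeast0LessThan)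
    moreover have "b \<notin> A" using insert.hyps by auto
    ultimately show ?thesis using insert.hyps by (simp add: algebra_simps)
  qed
  ultimately show ?case by linarith
qed

text \<open>Greedy choice: a new point joins the net exactly if no chosen point is within
  \<open>K\<close> of it.\<close>

lemma ex_separated_net:
  fixes d :: "'a \<Rightarrow> 'a \<Rightarrow> real"
  assumes "finite P" "\<And>x. x \<in> P \<Longrightarrow> d x x \<le> K" "\<And>x y. x \<in> P \<Longrightarrow> y \<in> P \<Longrightarrow> d x y = d y x"
  shows "\<exists>Q\<subseteq>P. (\<forall>p\<in>P. \<exists>q\<in>Q. d q p \<le> K) \<and> (\<forall>q\<in>Q. \<forall>q'\<in>Q. q \<noteq> q' \<longrightarrow> K < d q q')"
  using assms
proof (induction rule: finite_induct)
  case empty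
  then show ?case by auto
next
  case (insert x P)
  have "\<exists>Q\<subseteq>P. (\<forall>p\<in>P. \<exists>q\<in>Q. d q p \<le> K) \<and> (\<forall>q\<in>Q. \<forall>q'\<in>Q. q \<noteq> q' \<longrightarrow> K < d q q')"
    using insert.prems by (intro insert.IH) auto
  then obtain Q where Q: "Q \<subseteq> P" "\<forall>p\<in>P. \<exists>q\<in>Q. d q p \<le> K"
    "\<forall>q\<in>Q. \<forall>q'\<in>Q. q \<noteq> q' \<longrightarrow> K < d q q'"
    by (elim exE conjE)
  show ?case
  proof (cases "\<exists>q\<in>Q. d q x \<le> K")
    case True
    then show ?thesis using Q by (intro exI[of _ Q]) auto
  next
    case False
    have "K < d q x \<and> K < d x q" if "q \<in> Q" for q
    proof -
      have "d q x = d x q" using that Q(1) by (intro insert.prems(2)) auto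
      then show ?thesis using False that by auto
    qed
    then show ?thesis using Q insert.prems(1)
      by (intro exI[of _ "insert x Q"]) (auto simp: subset_iff)
  qed
qed

context Metric_space
begin

lemma dist_le_sum_steps:
  assumes "i \<le> j" "\<And>k. k \<in> {i..j} \<Longrightarrow> x k \<in> M"
  shows "d (x i) (x j) \<le> (\<Sum>k=i..<j. d (x k) (x (Suc k)))"
  using assms
proof (induction j rule: dec_induct)
  case base
  then show ?case by simp
next
  case (step n)
  have "d (x i) (x (Suc n)) \<le> d (x i) (x n) + d (x n) (x (Suc n))"
    using step by (intro triangle) auto
  with step show ?case by simp
qed

text \<open>The image of \<open>A\<close> is thinned to a \<open>K\<close>-separated net with one
  index per net point. Passing between two net points costs at least \<open>c\<close>, so their
  number is at most the total cost over \<open>c\<close> plus 1, and each of them stands for at most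
  \<open>B\<close> points. This serves twice: for ancestors at one level with weights as cost, and
  for retracted points with distances as cost.\<close>

lemma card_le_sum_steps:
  fixes f :: "nat \<Rightarrow> real"
  assumes f: "\<And>k. 0 \<le> f k" and "0 < c" "0 \<le> K"
    and A: "A \<subseteq> {..m}" "g ` A \<subseteq> M"
    and ball: "\<And>x. x \<in> M \<Longrightarrow> finite {y \<in> M. d x y \<le> K} \<and> card {y \<in> M. d x y \<le> K} \<le> B"
    and far: "\<And>i j. i \<in> A \<Longrightarrow> j \<in> A \<Longrightarrow> i < j \<Longrightarrow> K < d (g i) (g j) \<Longrightarrow> c \<le> sum f {i..<j}"
  shows "real (card (g ` A)) \<le> real B * (sum f {..<m} / c + 1)"
proof -
  have finA: "finite A" using finite_subset[OF A(1)] by simp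
  obtain Q where Q: "Q \<subseteq> g ` A" "\<forall>p\<in>g ` A. \<exists>q\<in>Q. d q p \<le> K"
    "\<forall>q\<in>Q. \<forall>q'\<in>Q. q \<noteq> q' \<longrightarrow> K < d q q'"
    using ex_separated_net[of "g ` A" d K] finA A(2) \<open>0 \<le> K\<close> commute by (auto simp: subset_iff)
  obtain I where I: "I \<subseteq> A" "inj_on g I" "Q = g ` I"
    using Q(1) unfolding subset_image_inj by blast
  have finI: "finite I" using I(1) finA finite_subset by blast
  have cQ: "card Q = card I" using I by (simp add: card_image)
  have "c * (real (card I) - 1) \<le> sum f {..<m}"
  proof (rule sum_ge_card_separated[OF finI f])
    fix i j assume ij: "i \<in> I" "j \<in> I" "i < j"
    then have "g i \<noteq> g j" using I(2) by (auto dest: inj_onD)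
    then show "c \<le> sum f {i..<j}" using ij I Q(3) by (intro far) auto
  qed (use \<open>0 < c\<close> I A in auto)
  then have cI: "real (card Q) \<le> sum f {..<m} / c + 1"
    using \<open>0 < c\<close> cQ by (simp add: field_simps)
  have QM: "Q \<subseteq> M" using Q(1) A(2) by auto
  have finQ: "finite Q" using I finI by simp
  have "g ` A \<subseteq> (\<Union>q\<in>Q. {y \<in> M. d q y \<le> K})"
    using Q(2) A(2) by blast
  then have "card (g ` A) \<le> card (\<Union>q\<in>Q. {y \<in> M. d q y \<le> K})"
    using ball QM finQ by (intro card_mono) auto
  also have "\<dots> \<le> (\<Sum>q\<in>Q. card {y \<in> M. d q y \<le> K})"
    using finQ by (rule card_UN_le)
  also have "\<dots> \<le> card Q * B"
    using ball QM sum_bounded_above[of Q "\<lambda>q. card {y \<in> M. d q y \<le> K}" B] by auto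
  finally have "real (card (g ` A)) \<le> real B * real (card Q)"
    by (metis mult.commute of_nat_le_iff of_nat_mult)
  also have "\<dots> \<le> real B * (sum f {..<m} / c + 1)"
    using cI by (intro mult_left_mono) auto
  finally show ?thesis .
qed

end

section \<open>Hierarchies of ancestors in a hyperbolic space\<close>

text \<open>The level \<open>h\<close> is the distance to the root of a geodesic spanning tree, and \<open>anc n x\<close>
  is the ancestor of \<open>x\<close> at level \<open>n\<close> in this tree (junk if \<open>n\<close> exceeds \<open>h x\<close>).\<close>

locale hyperbolic_hierarchy = Metric_space M d
  for M :: "'a set" and d :: "'a \<Rightarrow> 'a \<Rightarrow> real" +
  fixes h :: "'a \<Rightarrow> nat" and anc :: "nat \<Rightarrow> 'a \<Rightarrow> 'a" and \<delta> :: real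
  assumes delta_nonneg: "0 \<le> \<delta>"
    and four_point: "x \<in> M \<Longrightarrow> y \<in> M \<Longrightarrow> z \<in> M \<Longrightarrow>
      d x z + real (h y) \<le> max (d x y + real (h z)) (d y z + real (h x)) + \<delta>"
    and level_lipschitz: "x \<in> M \<Longrightarrow> y \<in> M \<Longrightarrow> \<bar>real (h x) - real (h y)\<bar> \<le> d x y"
    and dist_le_levels: "x \<in> M \<Longrightarrow> y \<in> M \<Longrightarrow> d x y \<le> real (h x) + real (h y)"
    and dist_ge_1: "x \<in> M \<Longrightarrow> y \<in> M \<Longrightarrow> x \<noteq> y \<Longrightarrow> 1 \<le> d x y"
    and anc_in: "x \<in> M \<Longrightarrow> n \<le> h x \<Longrightarrow> anc n x \<in> M"
    and level_anc: "x \<in> M \<Longrightarrow> n \<le> h x \<Longrightarrow> h (anc n x) = n"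
    and dist_anc: "x \<in> M \<Longrightarrow> n \<le> h x \<Longrightarrow> d x (anc n x) = real (h x) - real n"
    and anc_anc: "x \<in> M \<Longrightarrow> k \<le> n \<Longrightarrow> n \<le> h x \<Longrightarrow> anc k (anc n x) = anc k x"
begin

section \<open>Gromov products based at the root\<close>

definition gp :: "'a \<Rightarrow> 'a \<Rightarrow> real" where
  "gp x y = (real (h x) + real (h y) - d x y) / 2"

text \<open>The four-point condition with the root as fourth point, where \<open>h\<close> is the
  distance to the root. The factor 1/2 in the Gromov product halves the error.\<close>

lemma gp_ultra: "x \<in> M \<Longrightarrow> y \<in> M \<Longrightarrow> z \<in> M \<Longrightarrow> min (gp x y) (gp y z) - \<delta> / 2 \<le> gp x z"
  using four_point[of x y z] by (simp add: gp_def min_def max_def field_simps split: if_splits)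

lemma gp_le_level: "x \<in> M \<Longrightarrow> y \<in> M \<Longrightarrow> gp x y \<le> h x" "x \<in> M \<Longrightarrow> y \<in> M \<Longrightarrow> gp x y \<le> h y"
  using level_lipschitz[of x y] by (auto simp: gp_def)

lemma gp_nonneg: "x \<in> M \<Longrightarrow> y \<in> M \<Longrightarrow> 0 \<le> gp x y"
  using dist_le_levels[of x y] by (auto simp: gp_def)

lemma gp_self [simp]: "x \<in> M \<Longrightarrow> gp x x = h x"
  by (auto simp: gp_def)

lemma gp_commute: "gp x y = gp y x"
  by (simp add: gp_def commute)

lemma gp_anc: "x \<in> M \<Longrightarrow> n \<le> h x \<Longrightarrow> gp x (anc n x) = n"
  by (simp add: gp_def level_anc dist_anc)

lemma gp_ge_if_anc_eq:
  assumes "x \<in> M" "y \<in> M" "n \<le> h x" "n \<le> h y" "anc n x = anc n y"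
  shows "n \<le> gp x y"
proof -
  have "d x y \<le> d x (anc n x) + d y (anc n x)"
    using triangle[of x "anc n x" y] commute[of y] assms anc_in by auto
  then show ?thesis using assms dist_anc[of x n] dist_anc[of y n] by (simp add: gp_def)
qed

text \<open>Otherwise two applications of the ultrametric inequality along \<open>anc n x\<close>,
  \<open>x\<close>, \<open>y\<close>, \<open>anc n y\<close> give the two ancestors a Gromov product
  of at least \<open>n - \<delta>\<close>. As both lie at level \<open>n\<close>, their distance is
  then at most \<open>2 * \<delta>\<close>. This is the origin of the radius
  \<open>2 * \<delta>\<close> of the balls counted below.\<close>

lemma gp_less_if_anc_far:
  assumes "x \<in> M" "y \<in> M" "n \<le> h x" "n \<le> h y" "2 * \<delta> < d (anc n x) (anc n y)"
  shows "gp x y < n"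
proof (rule ccontr)
  assume *: "\<not> gp x y < n"
  have "min (gp (anc n x) x) (gp x y) - \<delta> / 2 \<le> gp (anc n x) y"
    using assms anc_in by (intro gp_ultra) auto
  moreover have "min (gp (anc n x) y) (gp y (anc n y)) - \<delta> / 2 \<le> gp (anc n x) (anc n y)"
    using assms anc_in by (intro gp_ultra) auto
  moreover have "gp (anc n x) x = n" "gp y (anc n y) = n"
    using assms gp_anc gp_commute by metis+
  ultimately have "n - \<delta> \<le> gp (anc n x) (anc n y)"
    using * delta_nonneg by (auto simp: min_def split: if_splits)
  moreover have "gp (anc n x) (anc n y) = n - d (anc n x) (anc n y) / 2"
    using assms level_anc by (simp add: gp_def)
  ultimately show False using assms by linarith
qed

section \<open>The visual quasi-metric\<close>

definition scale :: real where "scale = \<delta> + 1"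

text \<open>The visual quasi-metric known from the boundary, here on points of the space itself.
  Since \<open>gp x x = h x\<close> is finite, the diagonal is set to 0 by hand. With the divisor
  \<open>\<delta> + 1\<close> an error \<delta> in the Gromov product costs a factor of at most 2;
  the summand 1 keeps the divisor positive for \<delta> = 0.\<close>

definition visual :: "'a \<Rightarrow> 'a \<Rightarrow> real" where
  "visual x y = (if x = y then 0 else 2 powr (- gp x y / scale))"

lemma scale_pos: "0 < scale"
  using delta_nonneg by (simp add: scale_def)

lemma visual_nonneg: "0 \<le> visual x y"
  by (simp add: visual_def)

text \<open>Degenerate sides need care: \<open>visual\<close> vanishes on them whatever the Gromov
  product, so the side with a small product must have distinct ends. If \<open>x = y\<close>, the
  other side is the pair \<open>x\<close>, \<open>z\<close> itself.\<close>

lemma ex_gp_le2: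
  assumes "x \<in> M" "y \<in> M" "z \<in> M" "x \<noteq> z"
  shows "(x \<noteq> y \<and> gp x y \<le> gp x z + \<delta> / 2) \<or> (y \<noteq> z \<and> gp y z \<le> gp x z + \<delta> / 2)"
  using gp_ultra[of x y z] assms delta_nonneg
  by (cases "x = y"; cases "y = z") (auto simp: min_def split: if_splits)

lemma ex_gp_le3:
  assumes "x \<in> M" "y \<in> M" "z \<in> M" "w \<in> M" "x \<noteq> w"
  shows "(x \<noteq> y \<and> gp x y \<le> gp x w + \<delta>) \<or> (y \<noteq> z \<and> gp y z \<le> gp x w + \<delta>) \<or>
    (z \<noteq> w \<and> gp z w \<le> gp x w + \<delta>)"
proof (cases "x \<noteq> y \<and> gp x y \<le> gp x w + \<delta> / 2")
  case True
  then show ?thesis using delta_nonneg by auto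
next
  case False
  then have yw: "y \<noteq> w" "gp y w \<le> gp x w + \<delta> / 2"
    using ex_gp_le2[of x y w] assms by auto
  from ex_gp_le2[OF assms(2-4) yw(1)] yw(2) show ?thesis by auto
qed

text \<open>Two uses of the ultrametric inequality, each losing \<delta>/2, give a nondegenerate
  step among the three whose Gromov product exceeds that of \<open>x\<close> and \<open>w\<close> by
  at most \<delta>. After division by \<open>scale\<close> the exponents differ by at most
  1.\<close>

lemma visual_quasi:
  assumes "x \<in> M" "y \<in> M" "z \<in> M" "w \<in> M"
  shows "visual x w \<le> 2 * max (visual x y) (max (visual y z) (visual z w))"
proof (cases "x = w")
  case True
  then have "visual x w = 0" by (simp add: visual_def)
  then show ?thesis using visual_nonneg[of x y] by linarith
next
  case False
  have *: "visual x w \<le> 2 * visual a b" if "a \<noteq> b" "gp a b \<le> gp x w + \<delta>" for a b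
  proof -
    have "- gp x w / scale \<le> 1 + - gp a b / scale"
    proof -
      have "(gp a b - gp x w) / scale \<le> 1"
        using that scale_pos by (simp add: divide_le_eq_1 scale_def)
      then show ?thesis by (simp add: diff_divide_distrib)
    qed
    then have "2 powr (- gp x w / scale) \<le> 2 powr (1 + - gp a b / scale)"
      by (intro powr_mono) auto
    also have "\<dots> = 2 * 2 powr (- gp a b / scale)" by (subst powr_add) simp
    finally show ?thesis using False that by (simp add: visual_def)
  qed
  have "visual x w \<le> 2 * visual x y \<or> visual x w \<le> 2 * visual y z \<or> visual x w \<le> 2 * visual z w"
    using ex_gp_le3[OF assms False] * by blast
  then show ?thesis by linarith
qed

text \<open>The weight of a step at level \<open>n\<close>. Its exponential tail above level \<open>n\<close> accounts for
  chains of many short steps that together drift far away at level \<open>n\<close>.\<close>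

definition weight :: "nat \<Rightarrow> 'a \<Rightarrow> 'a \<Rightarrow> real" where
  "weight n x y = (if x = y \<or> max (h x) (h y) < n then 0
     else min 1 (2 powr ((real n - gp x y) / scale)))"

lemma weight_nonneg: "0 \<le> weight n x y"
  by (simp add: weight_def)

lemma weight_eq_1: "x \<noteq> y \<Longrightarrow> n \<le> max (h x) (h y) \<Longrightarrow> gp x y \<le> n \<Longrightarrow> weight n x y = 1"
  using scale_pos by (simp add: weight_def min_def not_less le_max_iff_disj ge_one_powr_ge_zero antisym)

text \<open>A chain that visits a level below \<open>n\<close> has a step across level
  \<open>n\<close>, and this step alone has weight 1; so has a nondegenerate step with Gromov
  product at most \<open>n\<close>. If neither occurs, no weight is cut off at 1, and the weights
  are the visual distances multiplied by \<open>2 powr (n / scale)\<close>. The chain estimate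
  applies, and the rescaled visual distance of the ends is at least 1 because their Gromov product
  is below \<open>n\<close>.\<close>

lemma chain_weight:
  assumes "i \<le> j" and M: "\<And>k. k \<in> {i..j} \<Longrightarrow> x k \<in> M"
    and n: "n \<le> max (h (x i)) (h (x j))" and gp: "gp (x i) (x j) < n"
  shows "1 / 2 \<le> (\<Sum>k=i..<j. weight n (x k) (x (Suc k)))"
proof -
  have one: ?thesis if "k \<in> {i..<j}" "weight n (x k) (x (Suc k)) = 1" for k
    using member_le_sum[of k "{i..<j}" "\<lambda>k. weight n (x k) (x (Suc k))"] that weight_nonneg
    by auto
  show ?thesis
  proof (cases "\<exists>k\<in>{i..j}. h (x k) < n")
    case True
    have "\<exists>k\<in>{i..<j}. (h (x k) < n) \<noteq> (h (x (Suc k)) < n)"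
    proof (rule ccontr)
      assume *: "\<not> ?thesis"
      have "k \<le> j \<Longrightarrow> (h (x k) < n) = (h (x i) < n)" if "i \<le> k" for k
        using that by (induction k rule: dec_induct) (use * in auto)
      then show False using True n \<open>i \<le> j\<close> by (metis atLeastAtMost_iff le_max_iff_disj not_le order_refl)
    qed
    then obtain k where k: "k \<in> {i..<j}" "(h (x k) < n) \<noteq> (h (x (Suc k)) < n)" by blast
    have "x k \<in> M" "x (Suc k) \<in> M" using k M by auto
    then have "weight n (x k) (x (Suc k)) = 1"
      using k(2) gp_le_level[of "x k" "x (Suc k)"] by (intro weight_eq_1) auto
    with k one show ?thesis by blast
  next
    case False
    show ?thesis
    proof (cases "\<exists>k\<in>{i..<j}. x k \<noteq> x (Suc k) \<and> gp (x k) (x (Suc k)) \<le> n")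
      case True
      then obtain k where k: "k \<in> {i..<j}" "x k \<noteq> x (Suc k)" "gp (x k) (x (Suc k)) \<le> n" by blast
      then have "weight n (x k) (x (Suc k)) = 1" using False
        by (intro weight_eq_1) (auto simp: not_less le_max_iff_disj)
      with k one show ?thesis by blast
    next
      case short: False
      have w: "weight n (x k) (x (Suc k)) = 2 powr (n / scale) * visual (x k) (x (Suc k))"
        if k: "k \<in> {i..<j}" for k
      proof (cases "x k = x (Suc k)")
        case True
        then show ?thesis by (simp add: weight_def visual_def)
      next
        case neq: False
        have "n \<le> h (x k)" using False k by (auto simp: not_less)
        moreover have "2 powr ((n - gp (x k) (x (Suc k))) / scale) \<le> 2 powr 0"
          using short k neq scale_pos by (intro powr_mono) (auto simp: field_simps)
        moreover have "2 powr ((n - gp (x k) (x (Suc k))) / scale) =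
          2 powr (n / scale) * 2 powr (- gp (x k) (x (Suc k)) / scale)"
          by (simp add: powr_add[symmetric] diff_divide_distrib)
        ultimately show ?thesis using neq by (auto simp: weight_def visual_def min_def)
      qed
      have "visual (x i) (x j) \<le> 2 * (\<Sum>k=i..<j. visual (x k) (x (Suc k)))"
      proof -
        \<comment> \<open>The chain estimate asks for the quasi-inequality at all indices up to
          \<open>j\<close>, but \<open>x\<close> is known to lie in \<open>M\<close> only from
          \<open>i\<close> to \<open>j\<close>. Clamping the index repeats the ends outside this
          range.\<close>
        define y where "y k = x (max i (min k j))" for k
        have y: "y k = x k" if "k \<in> {i..j}" for k using that by (auto simp: y_def)
        have "y k \<in> M" for k using M \<open>i \<le> j\<close> by (auto simp: y_def)
        then have "visual (y i) (y j) \<le> 2 * (\<Sum>k=i..<j. visual (y k) (y (Suc k)))"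
          by (intro chain_inequality[of "\<lambda>a b. visual (y a) (y b)" j] visual_quasi visual_nonneg)
            (use \<open>i \<le> j\<close> in \<open>auto simp: visual_def\<close>)
        also have "(\<Sum>k=i..<j. visual (y k) (y (Suc k))) = (\<Sum>k=i..<j. visual (x k) (x (Suc k)))"
          by (intro sum.cong) (auto simp: y)
        finally show ?thesis using \<open>i \<le> j\<close> by (simp add: y)
      qed
      then have "2 powr (n / scale) * visual (x i) (x j) \<le>
          2 * (\<Sum>k=i..<j. weight n (x k) (x (Suc k)))"
        by (simp add: w sum_distrib_left[symmetric] mult.left_commute[of 2])
      moreover have "x i \<noteq> x j"
        using gp n M[of i] \<open>i \<le> j\<close> by auto
      then have "2 powr (n / scale) * visual (x i) (x j) = 2 powr ((n - gp (x i) (x j)) / scale)"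
        by (simp add: visual_def powr_add[symmetric] diff_divide_distrib)
      moreover have "1 \<le> 2 powr ((n - gp (x i) (x j)) / scale)"
        using gp scale_pos by (intro ge_one_powr_ge_zero) auto
      ultimately show ?thesis by linarith
    qed
  qed
qed

definition weight_const :: real where
  "weight_const = 2 + 1 / (1 - 2 powr (- 1 / scale))"

text \<open>Let \<open>g\<close> be the integral part of the Gromov product. At most
  \<open>d x y + 1\<close> levels lie above \<open>g\<close> and up to the higher of the two points,
  each of weight at most 1. The levels up to \<open>g\<close> are dominated by a geometric series
  with ratio \<open>2 powr (- 1 / scale)\<close>. Both constants are absorbed because distinct
  points have distance at least 1, which gives the two summands of
  \<open>weight_const\<close>.\<close>

lemma sum_weight_le:
  assumes "x \<in> M" "y \<in> M"
  shows "(\<Sum>n\<le>H. weight n x y) \<le> weight_const * d x y"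
proof (cases "x = y")
  case True
  then show ?thesis using assms by (simp add: weight_def)
next
  case False
  define g where "g = nat \<lfloor>gp x y\<rfloor>"
  define m where "m = max (h x) (h y)"
  define q :: real where "q = 2 powr (- 1 / scale)"
  have q: "0 < q" "q < 1" using scale_pos powr_less_mono[of "- 1 / scale" 0 2] by (auto simp: q_def)
  have g: "g \<le> gp x y" "gp x y < g + 1" using gp_nonneg[OF assms] by (simp_all add: g_def) linarith
  have le: "weight n x y \<le> of_bool (n \<in> {g<..m}) + (if n \<le> g then q ^ (g - n) else 0)" for n
  proof (cases "n \<le> g")
    case True
    have "2 powr ((n - gp x y) / scale) \<le> 2 powr (- 1 / scale * real (g - n))"
      using True g(1) scale_pos by (intro powr_mono) (auto simp: field_simps of_nat_diff)
    also have "\<dots> = q ^ (g - n)" 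
      unfolding q_def powr_powr[symmetric] by (rule powr_realpow) simp
    finally show ?thesis using True q by (auto simp: weight_def)
  next
    case False
    then show ?thesis by (auto simp: weight_def m_def not_le)
  qed
  have "(\<Sum>n\<le>H. weight n x y) \<le>
      (\<Sum>n\<le>H. of_bool (n \<in> {g<..m})) + (\<Sum>n\<le>H. if n \<le> g then q ^ (g - n) else 0)"
    unfolding sum.distrib[symmetric] by (intro sum_mono le)
  moreover have "(\<Sum>n\<le>H. of_bool (n \<in> {g<..m})) \<le> 2 * d x y"
  proof -
    have "(\<Sum>n\<le>H. of_bool (n \<in> {g<..m})) = real (card ({..H} \<inter> {g<..m}))"
      by (simp add: of_bool_def sum.If_cases greaterThanAtMost_def greaterThan_def atMost_def Int_def)
    also have "\<dots> \<le> real (card {g<..m})"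
      by (intro of_nat_mono card_mono) auto
    also have "\<dots> \<le> real m - real g"
      using g gp_le_level[OF assms] by (auto simp: m_def)
    also have "\<dots> \<le> real m - gp x y + 1" using g by linarith
    also have "real m - gp x y \<le> d x y"
      using level_lipschitz[OF assms] by (auto simp: m_def gp_def max_def field_simps)
    finally show ?thesis using dist_ge_1[OF assms False] by linarith
  qed
  moreover have "(\<Sum>n\<le>H. if n \<le> g then q ^ (g - n) else 0) \<le> 1 / (1 - q) * d x y"
  proof -
    have "(\<Sum>n\<le>H. if n \<le> g then q ^ (g - n) else 0) = (\<Sum>n\<in>{..H} \<inter> {..g}. q ^ (g - n))"
      by (simp add: sum.If_cases) (auto intro!: sum.cong)
    also have "\<dots> \<le> (\<Sum>n\<in>{..g}. q ^ (g - n))"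
      using q by (intro sum_mono2) auto
    also have "\<dots> = (\<Sum>n\<in>{..g}. q ^ n)"
      by (rule sum.reindex_bij_witness[of _ "\<lambda>n. g - n" "\<lambda>n. g - n"]) auto
    also have "\<dots> = (\<Sum>n<Suc g. q ^ n)" by (simp add: lessThan_Suc_atMost)
    also have "\<dots> \<le> 1 / (1 - q)"
      using q by (simp add: sum_gp_strict divide_simps)
    also have "\<dots> \<le> 1 / (1 - q) * d x y"
      using q dist_ge_1[OF assms False] by (simp add: divide_simps)
    finally show ?thesis .
  qed
  ultimately show ?thesis by (simp add: weight_const_def q_def algebra_simps)
qed

section \<open>Jumps of a coherent tour against weights of an arbitrary tour\<close>

definition jump :: "nat \<Rightarrow> 'a \<Rightarrow> 'a \<Rightarrow> real" where
  "jump n x y = of_bool (n \<le> h x \<and> gp x y < n) + of_bool (n \<le> h y \<and> gp x y < n)"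

text \<open>The distance is exactly \<open>(h x - gp x y) + (h y - gp x y)\<close>. The integers
  \<open>n\<close> with \<open>gp x y < n \<le> h z\<close> number at least
  \<open>h z - gp x y\<close>: rounding goes the right way because levels are integers.\<close>

lemma dist_le_sum_jump:
  assumes "x \<in> M" "y \<in> M" "h x \<le> H" "h y \<le> H"
  shows "d x y \<le> (\<Sum>n\<le>H. jump n x y)"
proof -
  have *: "real (h z) - gp x y \<le> (\<Sum>n\<le>H. of_bool (n \<le> h z \<and> gp x y < n))" if "h z \<le> H" for z
  proof -
    define g where "g = nat \<lfloor>gp x y\<rfloor>"
    have g: "g \<le> gp x y" "gp x y < g + 1" using gp_nonneg[OF assms(1,2)] by (simp_all add: g_def) linarith
    have "{..H} \<inter> {n. n \<le> h z \<and> gp x y < n} = {g<..h z}"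
      using that g by auto
    then have "(\<Sum>n\<le>H. of_bool (n \<le> h z \<and> gp x y < n)) = real (card {g<..h z})"
      by (simp add: of_bool_def sum.If_cases)
    then show ?thesis using g by auto
  qed
  have "d x y = (real (h x) - gp x y) + (real (h y) - gp x y)" by (simp add: gp_def)
  also have "\<dots> \<le> (\<Sum>n\<le>H. jump n x y)"
    unfolding jump_def sum.distrib using *[of x] *[of y] assms by linarith
  finally show ?thesis .
qed

text \<open>For each tree vertex, the indices of its descendants form an interval.\<close>

definition coherent :: "(nat \<Rightarrow> 'a) \<Rightarrow> nat \<Rightarrow> bool" where
  "coherent x m \<longleftrightarrow> (\<forall>n i j k. i < j \<longrightarrow> j < k \<longrightarrow> k \<le> m \<longrightarrow> n \<le> h (x i) \<longrightarrow> n \<le> h (x k) \<longrightarrow>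
     anc n (x i) = anc n (x k) \<longrightarrow> n \<le> h (x j) \<and> anc n (x j) = anc n (x i))"

text \<open>At a jump the two points cannot share their ancestor at level \<open>n\<close>. Hence by
  coherence \<open>i\<close> is the last index below the ancestor that is left, and
  \<open>Suc i\<close> the first below the ancestor that is entered. Each ancestor is left at most
  once and entered at most once, whence the factor 2.\<close>

lemma sum_jump_le:
  fixes x m n
  assumes M: "x ` {..m} \<subseteq> M" and coh: "coherent x m"
  defines "P \<equiv> (\<lambda>i. anc n (x i)) ` {i. i \<le> m \<and> n \<le> h (x i)}"
  shows "(\<Sum>i<m. jump n (x i) (x (Suc i))) \<le> 2 * card P"
proof -
  have finP: "finite P" by (simp add: P_def)
  define J where "J i \<longleftrightarrow> gp (x i) (x (Suc i)) < n" for i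
  have J: "\<not> J i" if "i < m" "n \<le> h (x i)" "n \<le> h (x (Suc i))" "anc n (x i) = anc n (x (Suc i))" for i
    using gp_ge_if_anc_eq[of "x i" "x (Suc i)" n] that M by (auto simp: J_def image_subset_iff)
  have out: "card {i. i < m \<and> n \<le> h (x i) \<and> J i} \<le> card P"
  proof (rule card_inj_on_le[OF _ _ finP])
    show "inj_on (\<lambda>i. anc n (x i)) {i. i < m \<and> n \<le> h (x i) \<and> J i}"
    proof (rule linorder_inj_onI)
      fix i j assume ij: "i < j" "i \<in> {i. i < m \<and> n \<le> h (x i) \<and> J i}" "j \<in> {i. i < m \<and> n \<le> h (x i) \<and> J i}"
      show "anc n (x i) \<noteq> anc n (x j)"
      proof
        assume eq: "anc n (x i) = anc n (x j)"
        then have "n \<le> h (x (Suc i)) \<and> anc n (x (Suc i)) = anc n (x i)"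
          using coh[unfolded coherent_def, rule_format, of i "Suc i" j n] ij
          by (cases "Suc i = j") auto
        then show False using J[of i] ij by auto
      qed
    qed auto
  qed (auto simp: P_def)
  have into: "card {i. i < m \<and> n \<le> h (x (Suc i)) \<and> J i} \<le> card P"
  proof (rule card_inj_on_le[OF _ _ finP])
    show "inj_on (\<lambda>i. anc n (x (Suc i))) {i. i < m \<and> n \<le> h (x (Suc i)) \<and> J i}"
    proof (rule linorder_inj_onI)
      fix i j assume ij: "i < j" "i \<in> {i. i < m \<and> n \<le> h (x (Suc i)) \<and> J i}"
        "j \<in> {i. i < m \<and> n \<le> h (x (Suc i)) \<and> J i}"
      show "anc n (x (Suc i)) \<noteq> anc n (x (Suc j))"
      proof
        assume eq: "anc n (x (Suc i)) = anc n (x (Suc j))"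
        then have "n \<le> h (x j) \<and> anc n (x j) = anc n (x (Suc i))"
          using coh[unfolded coherent_def, rule_format, of "Suc i" j "Suc j" n] ij
          by (cases "Suc i = j") auto
        then show False using J[of j] ij eq by auto
      qed
    qed auto
  qed (auto simp: P_def)
  have *: "(\<Sum>i<m. of_bool (Q i)) = real (card {i. i < m \<and> Q i})" for Q
  proof -
    have "{..<m} \<inter> {i. Q i} = {i. i < m \<and> Q i}" by auto
    then show ?thesis by (simp add: of_bool_def sum.If_cases)
  qed
  have "(\<Sum>i<m. jump n (x i) (x (Suc i))) =
    real (card {i. i < m \<and> n \<le> h (x i) \<and> J i}) + real (card {i. i < m \<and> n \<le> h (x (Suc i)) \<and> J i})"
    by (simp add: jump_def sum.distrib * J_def)
  then show ?thesis using out into by linarith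
qed

text \<open>Ancestors more than \<open>2 * \<delta>\<close> apart cost the tour \<open>y\<close> at
  least 1/2, so with total weight \<open>W\<close> there are at most \<open>B * (2 * W + 1)\<close>
  of them. The additive 1 is harmless: if there is any jump at all, \<open>y\<close> must also pass
  between the two points involved, so \<open>W\<close> is at least 1/2 and the bound is at most
  \<open>4 * B * W\<close>. Two jumps per ancestor give the constant 8.\<close>

lemma sum_jump_le_sum_weight:
  assumes xM: "x ` {..m} \<subseteq> M" and coh: "coherent x m"
    and yM: "y ` {..l} \<subseteq> M" and sub: "x ` {..m} \<subseteq> y ` {..l}"
    and ball: "\<And>x. x \<in> M \<Longrightarrow> finite {y \<in> M. d x y \<le> 2 * \<delta>} \<and> card {y \<in> M. d x y \<le> 2 * \<delta>} \<le> B"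
  shows "(\<Sum>i<m. jump n (x i) (x (Suc i))) \<le> 8 * real B * (\<Sum>i<l. weight n (y i) (y (Suc i)))"
    (is "?U \<le> 8 * real B * ?W")
proof (cases "\<exists>i<m. jump n (x i) (x (Suc i)) \<noteq> 0")
  case False
  moreover have "0 \<le> ?W" by (simp add: sum_nonneg weight_nonneg)
  ultimately show ?thesis by simp
next
  case True
  have chain: "1 / 2 \<le> (\<Sum>k=i..<j. weight n (y k) (y (Suc k)))"
    if "i \<le> j" "j \<le> l" "n \<le> max (h (y i)) (h (y j))" "gp (y i) (y j) < n" for i j
    using that yM by (intro chain_weight) auto
  from True obtain i where i: "i < m" "gp (x i) (x (Suc i)) < n" "n \<le> max (h (x i)) (h (x (Suc i)))"
    by (auto simp: jump_def of_bool_def le_max_iff_disj split: if_splits)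
  obtain a b where ab: "a \<le> l" "b \<le> l" "x i = y a" "x (Suc i) = y b"
  proof -
    have "x i \<in> y ` {..l}" "x (Suc i) \<in> y ` {..l}" using sub i(1) by auto
    then show ?thesis using that by auto
  qed
  have "\<exists>a b. a \<le> b \<and> b \<le> l \<and> n \<le> max (h (y a)) (h (y b)) \<and> gp (y a) (y b) < n"
    using i ab gp_commute max.commute by (metis nle_le)
  then obtain a b where "a \<le> b" "b \<le> l" "1 / 2 \<le> (\<Sum>k=a..<b. weight n (y k) (y (Suc k)))"
    using chain by blast
  moreover have "(\<Sum>k=a..<b. weight n (y k) (y (Suc k))) \<le> ?W"
    using \<open>b \<le> l\<close> by (intro sum_mono2) (auto simp: weight_nonneg)
  ultimately have half: "1 / 2 \<le> ?W" by linarith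
  let ?P = "\<lambda>x m. (\<lambda>i. anc n (x i)) ` {i. i \<le> m \<and> n \<le> h (x i)}"
  have "card (?P x m) \<le> card (?P y l)"
  proof (rule card_mono)
    show "?P x m \<subseteq> ?P y l"
    proof
      fix p assume "p \<in> ?P x m"
      then obtain i where i: "i \<le> m" "n \<le> h (x i)" "p = anc n (x i)" by auto
      then obtain a where "a \<le> l" "x i = y a" using sub by auto
      with i show "p \<in> ?P y l" by auto
    qed
  qed auto
  moreover have "real (card (?P y l)) \<le> real B * (?W / (1 / 2) + 1)"
  proof (rule card_le_sum_steps[OF weight_nonneg _ _ _ _ ball])
    fix i j assume "i \<in> {i. i \<le> l \<and> n \<le> h (y i)}" "j \<in> {i. i \<le> l \<and> n \<le> h (y i)}" "i < j"
      "2 * \<delta> < d (anc n (y i)) (anc n (y j))"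
    then show "1 / 2 \<le> (\<Sum>k=i..<j. weight n (y k) (y (Suc k)))"
      using yM gp_less_if_anc_far[of "y i" "y j" n] by (intro chain) (auto simp: image_subset_iff)
  qed (use yM delta_nonneg anc_in in auto)
  moreover have "real B * (?W / (1 / 2) + 1) \<le> real B * (4 * ?W)"
    using half by (intro mult_left_mono) auto
  moreover have "?U \<le> 2 * card (?P x m)" by (rule sum_jump_le[OF xM coh])
  ultimately show ?thesis by (simp add: mult.left_commute)
qed

lemma coherent_length_le:
  assumes xM: "x ` {..m} \<subseteq> M" and coh: "coherent x m"
    and yM: "y ` {..l} \<subseteq> M" and sub: "x ` {..m} \<subseteq> y ` {..l}"
    and ball: "\<And>x. x \<in> M \<Longrightarrow> finite {y \<in> M. d x y \<le> 2 * \<delta>} \<and> card {y \<in> M. d x y \<le> 2 * \<delta>} \<le> B"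
  shows "(\<Sum>i<m. d (x i) (x (Suc i))) \<le> 8 * real B * weight_const * (\<Sum>i<l. d (y i) (y (Suc i)))"
proof -
  \<comment> \<open>There are no jumps above the highest level met by \<open>x\<close>, so finitely
    many levels suffice. The bound on the weights does not depend on \<open>H\<close>.\<close>
  define H where "H = Max ((\<lambda>i. h (x i)) ` {..m})"
  have H: "h (x i) \<le> H" if "i \<le> m" for i using that by (auto simp: H_def)
  have "(\<Sum>i<m. d (x i) (x (Suc i))) \<le> (\<Sum>i<m. \<Sum>n\<le>H. jump n (x i) (x (Suc i)))"
    using xM H by (intro sum_mono dist_le_sum_jump) (auto simp: image_subset_iff)
  also have "\<dots> = (\<Sum>n\<le>H. \<Sum>i<m. jump n (x i) (x (Suc i)))"
    by (rule sum.swap)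
  also have "\<dots> \<le> (\<Sum>n\<le>H. 8 * real B * (\<Sum>i<l. weight n (y i) (y (Suc i))))"
    by (intro sum_mono sum_jump_le_sum_weight assms)
  also have "\<dots> = 8 * real B * (\<Sum>i<l. \<Sum>n\<le>H. weight n (y i) (y (Suc i)))"
    unfolding sum_distrib_left[symmetric] by (subst sum.swap) rule
  also have "\<dots> \<le> 8 * real B * (\<Sum>i<l. weight_const * d (y i) (y (Suc i)))"
    using yM by (intro mult_left_mono sum_mono sum_weight_le) (auto simp: image_subset_iff)
  also have "\<dots> = 8 * real B * weight_const * (\<Sum>i<l. d (y i) (y (Suc i)))"
    by (simp add: sum_distrib_left[symmetric])
  finally show ?thesis .
qed

end

section \<open>Passing from the net to the whole space\<close>

lemma ex_representative_subsequence:
  fixes g :: "nat \<Rightarrow> 'b"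
  obtains s n where "strict_mono_on {..n} s" "s n \<le> l" "g ` s ` {..n} = g ` {..l}"
    "n < card (g ` {..l})"
proof -
  obtain I where I: "I \<subseteq> {..l}" "inj_on g I" "g ` {..l} = g ` I"
    using subset_image_inj[of "g ` {..l}" g "{..l}"] by auto
  have finI: "finite I" using I(1) finite_subset by blast
  have "I \<noteq> {}" using I(3) by auto
  define s where "s = (!) (sorted_list_of_set I)"
  define n where "n = card I - 1"
  have card: "card I = Suc n" using \<open>I \<noteq> {}\<close> finI by (simp add: n_def card_gt_0_iff)
  have im: "s ` {..n} = I"
    using card finI set_conv_nth[of "sorted_list_of_set I"]
    by (auto simp: s_def less_Suc_eq_le)
  show ?thesis
  proof (rule that[of n s])
    show "strict_mono_on {..n} s"
      using strict_sorted_list_of_set[of I] card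
      by (auto simp: strict_mono_on_def s_def sorted_wrt_iff_nth_less)
    show "s n \<le> l" using im I(1) by blast
    show "g ` s ` {..n} = g ` {..l}" using im I(3) by simp
    show "n < card (g ` {..l})" using I(2,3) card by (simp add: card_image)
  qed
qed

context Metric_space
begin

lemma subsequence_length_le:
  assumes "strict_mono_on {..n} s" "y ` {..s n} \<subseteq> M"
  shows "(\<Sum>k<n. d (y (s k)) (y (s (Suc k)))) \<le> (\<Sum>i=s 0..<s n. d (y i) (y (Suc i)))"
  using assms
proof (induction n)
  case 0
  then show ?case by simp
next
  case (Suc n)
  have mono: "s i \<le> s j" if "i \<le> j" "j \<le> Suc n" for i j
    using strict_mono_onD[OF Suc.prems(1), of i j] that by (cases "i = j") auto
  have "(\<Sum>k<n. d (y (s k)) (y (s (Suc k)))) \<le> (\<Sum>i=s 0..<s n. d (y i) (y (Suc i)))"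
    using Suc.prems mono[of n "Suc n"]
    by (intro Suc.IH) (auto intro: monotone_on_subset simp: image_subset_iff)
  moreover have "d (y (s n)) (y (s (Suc n))) \<le> (\<Sum>i=s n..<s (Suc n). d (y i) (y (Suc i)))"
    using Suc.prems(2) mono[of n "Suc n"] by (intro dist_le_sum_steps) auto
  moreover have "(\<Sum>i=s 0..<s (Suc n). d (y i) (y (Suc i))) =
      (\<Sum>i=s 0..<s n. d (y i) (y (Suc i))) + (\<Sum>i=s n..<s (Suc n). d (y i) (y (Suc i)))"
    using mono[of 0 n] mono[of n "Suc n"] by (simp add: sum.atLeastLessThan_concat)
  ultimately show ?case by simp
qed

text \<open>The indices in one cell form an interval on which \<open>u\<close> is monotone, so the
  steps inside the cell telescope to the distance between its first and its last point, however many
  points lie between them.\<close>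

lemma sum_steps_within_cells_le:
  fixes u :: "'a \<Rightarrow> real" and w :: real
  assumes "0 \<le> w"
    and convex: "\<And>i j k. i < j \<Longrightarrow> j < k \<Longrightarrow> k \<le> m \<Longrightarrow> c (x i) = c (x k) \<Longrightarrow> c (x j) = c (x i)"
    and mono: "\<And>i j. i < j \<Longrightarrow> j \<le> m \<Longrightarrow> c (x i) = c (x j) \<Longrightarrow> u (x i) \<le> u (x j)"
    and dist: "\<And>i j. i \<le> m \<Longrightarrow> j \<le> m \<Longrightarrow> c (x i) = c (x j) \<Longrightarrow> d (x i) (x j) = \<bar>u (x i) - u (x j)\<bar>"
    and w: "\<And>i j. i \<le> m \<Longrightarrow> j \<le> m \<Longrightarrow> c (x i) = c (x j) \<Longrightarrow> d (x i) (x j) \<le> w"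
  shows "(\<Sum>i | i < m \<and> c (x i) = c (x (Suc i)). d (x i) (x (Suc i))) \<le>
    card ((\<lambda>i. c (x i)) ` {..m}) * w"
proof -
  let ?J = "{i. i < m \<and> c (x i) = c (x (Suc i))}"
  let ?C = "(\<lambda>i. c (x i)) ` {..m}"
  have "(\<Sum>i | i < m \<and> c (x i) = c (x (Suc i)). d (x i) (x (Suc i))) =
      (\<Sum>q\<in>?C. \<Sum>i | i \<in> ?J \<and> c (x i) = q. d (x i) (x (Suc i)))"
    by (intro sum.group[symmetric]) auto
  also have "\<dots> \<le> (\<Sum>q\<in>?C. w)"
  proof (rule sum_mono)
    fix q assume "q \<in> ?C"
    define E where "E = {i. i \<le> m \<and> c (x i) = q}"
    have finE: "finite E" and "E \<noteq> {}" using \<open>q \<in> ?C\<close> by (auto simp: E_def)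
    define a b where "a = Min E" and "b = Max E"
    have a: "a \<in> E" "\<And>i. i \<in> E \<Longrightarrow> a \<le> i" and b: "b \<in> E" "\<And>i. i \<in> E \<Longrightarrow> i \<le> b"
      using finE \<open>E \<noteq> {}\<close> by (auto simp: a_def b_def)
    have "a \<le> b" using a b by auto
    have E: "i \<in> E" if "a \<le> i" "i \<le> b" for i
      using that a(1) b(1) convex[of a i b] by (cases "a = i"; cases "i = b") (auto simp: E_def)
    have step: "d (x i) (x (Suc i)) = u (x (Suc i)) - u (x i)" if "i \<in> E" "Suc i \<in> E" for i
      using that dist[of i "Suc i"] mono[of i "Suc i"] by (auto simp: E_def)
    have sub: "{i \<in> ?J. c (x i) = q} \<subseteq> {a..<b}"
    proof
      fix i assume "i \<in> {i \<in> ?J. c (x i) = q}"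
      then have "i \<in> E" "Suc i \<in> E" by (auto simp: E_def)
      then show "i \<in> {a..<b}" using a(2)[of i] b(2)[of "Suc i"] by auto
    qed
    have "(\<Sum>i | i \<in> ?J \<and> c (x i) = q. d (x i) (x (Suc i))) \<le> (\<Sum>i=a..<b. d (x i) (x (Suc i)))"
      using sub by (intro sum_mono2) auto
    also have "\<dots> = (\<Sum>i=a..<b. u (x (Suc i)) - u (x i))"
      using E by (intro sum.cong step) auto
    also have "\<dots> = u (x b) - u (x a)" using \<open>a \<le> b\<close> by (rule sum_Suc_diff')
    also have "\<dots> \<le> \<bar>u (x a) - u (x b)\<bar>" by simp
    also have "\<dots> = d (x a) (x b)" using a(1) b(1) by (intro dist[symmetric]) (auto simp: E_def)
    also have "\<dots> \<le> w" using a(1) b(1) by (intro w) (auto simp: E_def)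
    finally show "(\<Sum>i | i \<in> ?J \<and> c (x i) = q. d (x i) (x (Suc i))) \<le> w" .
  qed
  finally show ?thesis by simp
qed

end

text \<open>An index at which \<open>c\<close> changes is the last one of its cell, so
  \<open>c\<close> is injective on these indices.\<close>

lemma card_changes_le:
  fixes m :: nat
  assumes "\<And>i j k. i < j \<Longrightarrow> j < k \<Longrightarrow> k \<le> m \<Longrightarrow> c i = c k \<Longrightarrow> c j = c i"
  shows "card {i. i < m \<and> c i \<noteq> c (Suc i)} \<le> card (c ` {..m})"
proof (rule card_inj_on_le)
  show "inj_on c {i. i < m \<and> c i \<noteq> c (Suc i)}"
  proof (rule linorder_inj_onI)
    fix i j assume "i < j" "i \<in> {i. i < m \<and> c i \<noteq> c (Suc i)}" "j \<in> {i. i < m \<and> c i \<noteq> c (Suc i)}"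
    then show "c i \<noteq> c j" using assms[of i "Suc i" j] by (cases "Suc i = j") auto
  qed auto
qed auto

text \<open>The metric space \<open>M\<close> is retracted to the net \<open>V\<close> by \<open>r\<close>; the fibres of \<open>c\<close> are
  cells, on each of which \<open>u\<close> is an isometry to the reals.\<close>

locale hierarchical_net = Metric_space M d + net: hyperbolic_hierarchy V d h anc \<delta>
  for M :: "'a set" and d :: "'a \<Rightarrow> 'a \<Rightarrow> real" and V h anc \<delta> +
  fixes r :: "'a \<Rightarrow> 'a" and c :: "'a \<Rightarrow> 'c" and u :: "'a \<Rightarrow> real" and B :: "real \<Rightarrow> nat" and D :: nat
  assumes V_sub: "V \<subseteq> M"
    and r_in: "p \<in> M \<Longrightarrow> r p \<in> V"
    and dist_r: "p \<in> M \<Longrightarrow> d p (r p) \<le> 1"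
    and ball: "x \<in> V \<Longrightarrow> finite {y \<in> V. d x y \<le> K} \<and> card {y \<in> V. d x y \<le> K} \<le> B K"
    and cells: "x \<in> V \<Longrightarrow> finite (c ` {p \<in> M. r p = x}) \<and> card (c ` {p \<in> M. r p = x}) \<le> D"
    and cell_dist: "p \<in> M \<Longrightarrow> q \<in> M \<Longrightarrow> c p = c q \<Longrightarrow> d p q = \<bar>u p - u q\<bar>"
    and u_range: "p \<in> M \<Longrightarrow> 0 \<le> u p \<and> u p \<le> 1"
begin

text \<open>Collects what the length estimate needs of a sorted sequence, so that the estimate is
  independent of the construction of the order.\<close>

definition adapted :: "(nat \<Rightarrow> 'a) \<Rightarrow> nat \<Rightarrow> bool" where
  "adapted x m \<longleftrightarrow> x ` {..m} \<subseteq> M \<and> net.coherent (r \<circ> x) m \<and>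
    (\<forall>i j k. i < j \<longrightarrow> j < k \<longrightarrow> k \<le> m \<longrightarrow> c (x i) = c (x k) \<longrightarrow> c (x j) = c (x i)) \<and>
    (\<forall>i j. i < j \<longrightarrow> j \<le> m \<longrightarrow> c (x i) = c (x j) \<longrightarrow> u (x i) \<le> u (x j))"

definition net_const :: real where
  "net_const = 8 * real (B (2 * \<delta>)) * net.weight_const"

text \<open>The radius 3 is the threshold 1 for the length of a tour plus the additive error 2 of
  the retraction. The factor \<open>1 + 4 * B 3\<close> is the stretch of a thinned and retracted
  tour of length at least 1. Cells contribute \<open>6 * D * B 3\<close> for tours of length at
  least 1 and \<open>2 * D * B 3\<close> for shorter ones; the coefficient 8 covers both.\<close>

definition length_const :: real where
  "length_const = net_const * (1 + 4 * B 3) + 8 * D * B 3"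

lemma dist_r_r: "p \<in> M \<Longrightarrow> q \<in> M \<Longrightarrow> d (r p) (r q) \<le> d p q + 2"
  using triangle[of "r p" p "r q"] triangle[of p q "r q"] dist_r[of p] dist_r[of q] r_in V_sub
    commute[of p "r p"]
  by (auto simp: subset_iff)

lemma dist_le_r_r: "p \<in> M \<Longrightarrow> q \<in> M \<Longrightarrow> d p q \<le> d (r p) (r q) + 2"
  using triangle[of p "r p" q] triangle[of "r p" "r q" q] dist_r[of p] dist_r[of q] r_in V_sub
    commute[of q "r q"]
  by (auto simp: subset_iff)

lemma net_const_nonneg: "0 \<le> net_const"
proof -
  have "2 powr (- 1 / net.scale) \<le> 2 powr 0"
    using net.scale_pos by (intro powr_mono) auto
  then show ?thesis by (simp add: net_const_def net.weight_const_def)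
qed

text \<open>Steps inside cells cost at most one diameter per cell, and at most one step per cell
  leaves it. If \<open>L < 1\<close>, the points lie in boundedly many cells and no distance between
  them exceeds \<open>L\<close>. If \<open>L \<ge> 1\<close>, the number of cells is at most a
  multiple of \<open>L\<close>, so steps between cells can be compared with steps of the net at an
  additive cost of 2 each.\<close>

lemma adapted_length_le:
  assumes x: "adapted x m" and yM: "y ` {..l} \<subseteq> M" and eq: "x ` {..m} = y ` {..l}"
  shows "(\<Sum>i<m. d (x i) (x (Suc i))) \<le> length_const * (\<Sum>i<l. d (y i) (y (Suc i)))"
proof -
  define L where "L = (\<Sum>i<l. d (y i) (y (Suc i)))"
  define C where "C = (\<lambda>i. c (x i)) ` {..m}"
  define R where "R = (\<lambda>i. r (y i)) ` {..l}"
  have xM: "x ` {..m} \<subseteq> M" and coh: "net.coherent (r \<circ> x) m"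
    and convex: "\<And>i j k. i < j \<Longrightarrow> j < k \<Longrightarrow> k \<le> m \<Longrightarrow> c (x i) = c (x k) \<Longrightarrow> c (x j) = c (x i)"
    and mono: "\<And>i j. i < j \<Longrightarrow> j \<le> m \<Longrightarrow> c (x i) = c (x j) \<Longrightarrow> u (x i) \<le> u (x j)"
    using x unfolding adapted_def by blast+
  have xin: "x i \<in> M" if "i \<le> m" for i using xM that by auto
  have yin: "y i \<in> M" if "i \<le> l" for i using yM that by auto
  have L0: "0 \<le> L" by (simp add: L_def sum_nonneg)
  have le_L: "d p q \<le> L" if pq: "p \<in> x ` {..m}" "q \<in> x ` {..m}" for p q
  proof -
    have *: "d (y a) (y b) \<le> L" if "a \<le> b" "b \<le> l" for a b
    proof -
      have "d (y a) (y b) \<le> (\<Sum>i=a..<b. d (y i) (y (Suc i)))"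
        using that yM by (intro dist_le_sum_steps) auto
      also have "\<dots> \<le> L" unfolding L_def using that by (intro sum_mono2) auto
      finally show ?thesis .
    qed
    obtain a b where "a \<le> l" "b \<le> l" "p = y a" "q = y b" using pq eq by auto
    then show ?thesis using *[of a b] *[of b a] commute by (metis nle_le)
  qed
  have RV: "R \<subseteq> V" using yM r_in by (auto simp: R_def)
  have finR: "finite R" by (simp add: R_def)
  have CR: "card C \<le> D * card R"
  proof -
    have "C \<subseteq> (\<Union>v\<in>R. c ` {p \<in> M. r p = v})"
    proof
      fix q assume "q \<in> C"
      then obtain i where i: "i \<le> m" "q = c (x i)" by (auto simp: C_def)
      then have "x i \<in> y ` {..l}" using eq by auto
      then obtain a where "a \<le> l" "x i = y a" by auto
      then show "q \<in> (\<Union>v\<in>R. c ` {p \<in> M. r p = v})" using i xin[of i] by (auto simp: R_def)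
    qed
    then have "card C \<le> card (\<Union>v\<in>R. c ` {p \<in> M. r p = v})"
      using cells RV finR by (intro card_mono) auto
    also have "\<dots> \<le> (\<Sum>v\<in>R. card (c ` {p \<in> M. r p = v}))"
      using finR by (rule card_UN_le)
    also have "\<dots> \<le> card R * D"
      using cells RV sum_bounded_above[of R "\<lambda>v. card (c ` {p \<in> M. r p = v})" D] by auto
    finally show ?thesis by (simp add: mult.commute)
  qed
  \<comment> \<open>Both bounds on the extent of the set within a cell are kept: \<open>L\<close> is
    used for short tours and 1 for long ones.\<close>
  have inner: "(\<Sum>i | i < m \<and> c (x i) = c (x (Suc i)). d (x i) (x (Suc i))) \<le> card C * min 1 L"
    unfolding C_def
  proof (rule sum_steps_within_cells_le[where u = u])
    show "0 \<le> min 1 L" using L0 by simp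
  next
    fix i j k assume "i < j" "j < k" "k \<le> m" "c (x i) = c (x k)"
    then show "c (x j) = c (x i)" by (rule convex)
  next
    fix i j assume "i < j" "j \<le> m" "c (x i) = c (x j)"
    then show "u (x i) \<le> u (x j)" by (rule mono)
  next
    fix i j assume ij: "i \<le> m" "j \<le> m" "c (x i) = c (x j)"
    show "d (x i) (x j) = \<bar>u (x i) - u (x j)\<bar>" using ij xin by (intro cell_dist) auto
    moreover have "\<bar>u (x i) - u (x j)\<bar> \<le> 1" using u_range xin ij by (smt (verit))
    ultimately show "d (x i) (x j) \<le> min 1 L" using le_L[of "x i" "x j"] ij by simp
  qed
  have changes: "card {i. i < m \<and> c (x i) \<noteq> c (x (Suc i))} \<le> card C"
    unfolding C_def using convex by (rule card_changes_le)
  have split: "(\<Sum>i<m. d (x i) (x (Suc i))) =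
    (\<Sum>i | i < m \<and> c (x i) = c (x (Suc i)). d (x i) (x (Suc i))) +
    (\<Sum>i | i < m \<and> c (x i) \<noteq> c (x (Suc i)). d (x i) (x (Suc i)))"
  proof -
    have "{..<m} = {i. i < m \<and> c (x i) = c (x (Suc i))} \<union> {i. i < m \<and> c (x i) \<noteq> c (x (Suc i))}"
      by auto
    then show ?thesis by (simp only:) (rule sum.union_disjoint; auto)
  qed
  show ?thesis
  proof (cases "L < 1")
    case True
    have "r (y 0) \<in> V" using yM r_in by auto
    have "R \<subseteq> {v \<in> V. d (r (y 0)) v \<le> 3}"
    proof
      fix v assume "v \<in> R"
      then obtain i where i: "i \<le> l" "v = r (y i)" by (auto simp: R_def)
      have "d (r (y 0)) v \<le> d (y 0) (y i) + 2" unfolding i(2)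
        using i yM by (intro dist_r_r) auto
      also have "d (y 0) (y i) \<le> L" using i by (intro le_L) (auto simp: eq)
      finally show "v \<in> {v \<in> V. d (r (y 0)) v \<le> 3}" using True \<open>v \<in> R\<close> RV by auto
    qed
    then have "card R \<le> B 3"
      using ball[OF \<open>r (y 0) \<in> V\<close>, of 3] card_mono le_trans by blast
    then have C: "card C \<le> D * B 3" using CR by (meson le_trans mult_le_mono2)
    have "(\<Sum>i | i < m \<and> c (x i) \<noteq> c (x (Suc i)). d (x i) (x (Suc i))) \<le>
      (\<Sum>i | i < m \<and> c (x i) \<noteq> c (x (Suc i)). L)"
      by (intro sum_mono le_L) auto
    also have "\<dots> = card {i. i < m \<and> c (x i) \<noteq> c (x (Suc i))} * L" by simp
    also have "\<dots> \<le> card C * L" using changes L0 by (intro mult_right_mono) auto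
    finally have "(\<Sum>i<m. d (x i) (x (Suc i))) \<le> 2 * card C * L"
      using inner True split by simp
    also have "\<dots> \<le> length_const * L"
    proof (rule mult_right_mono[OF _ L0])
      have "real (card C) \<le> real D * real (B 3)"
        using of_nat_mono[OF C, where 'a = real] by simp
      moreover have "0 \<le> net_const * (1 + 4 * real (B 3))" using net_const_nonneg by simp
      moreover have "0 \<le> real D * real (B 3)" by simp
      ultimately show "real (2 * card C) \<le> length_const"
        by (simp add: length_const_def)
    qed
    finally show ?thesis by (simp add: L_def)
  next
    case False
    have "real (card R) \<le> B 3 * (L / 1 + 1)" unfolding R_def L_def
    proof (rule net.card_le_sum_steps[OF _ _ _ _ _ ball])
      fix i j assume ij: "i \<in> {..l}" "j \<in> {..l}" "i < j" "3 < d (r (y i)) (r (y j))"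
      then have "1 \<le> d (y i) (y j)" using dist_r_r[of "y i" "y j"] yin[of i] yin[of j] by auto
      also have "\<dots> \<le> (\<Sum>i=i..<j. d (y i) (y (Suc i)))"
        using ij yin by (intro dist_le_sum_steps) auto
      finally show "1 \<le> (\<Sum>i=i..<j. d (y i) (y (Suc i)))" .
    qed (use RV in \<open>auto simp: R_def\<close>)
    also have "\<dots> \<le> B 3 * (2 * L)" using False by (intro mult_left_mono) auto
    finally have cR: "real (card R) \<le> 2 * B 3 * L" by simp
    have "real (card C) \<le> D * real (card R)" using CR by (metis of_nat_le_iff of_nat_mult)
    also have "\<dots> \<le> D * (2 * B 3 * L)" using cR by (intro mult_left_mono) auto
    finally have cC: "real (card C) \<le> 2 * D * B 3 * L" by (simp add: mult_ac)
    \<comment> \<open>The tour \<open>y\<close> may have arbitrarily many points near one net point,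
      so an error of 2 per step would not be bounded by \<open>L\<close>. One index for each net
      point visited leaves fewer than \<open>card R\<close> steps, and \<open>card R\<close> is at
      most \<open>2 * B 3 * L\<close>.\<close>
    obtain s n where s: "strict_mono_on {..n} s" "s n \<le> l"
      "(r \<circ> y) ` s ` {..n} = (r \<circ> y) ` {..l}" "n < card ((r \<circ> y) ` {..l})"
      by (rule ex_representative_subsequence)
    have n: "n < card R" using s(4) by (simp add: R_def o_def)
    have sl: "s i \<le> l" if "i \<le> n" for i
      using strict_mono_onD[OF s(1), of i n] s(2) that by (cases "i = n") auto
    have "(\<Sum>i<m. d ((r \<circ> x) i) ((r \<circ> x) (Suc i))) \<le>
      net_const * (\<Sum>i<n. d ((r \<circ> y \<circ> s) i) ((r \<circ> y \<circ> s) (Suc i)))"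
      unfolding net_const_def
    proof (rule net.coherent_length_le[OF _ coh _ _ ball])
      show "(r \<circ> x) ` {..m} \<subseteq> V" using xM r_in by auto
      show "(r \<circ> y \<circ> s) ` {..n} \<subseteq> V" using yin sl r_in by auto
      have "(r \<circ> x) ` {..m} = (r \<circ> y) ` {..l}" by (simp only: image_comp[symmetric] eq)
      then show "(r \<circ> x) ` {..m} \<subseteq> (r \<circ> y \<circ> s) ` {..n}"
        using s(3) by (simp add: image_comp)
    qed
    also have "\<dots> \<le> net_const * ((1 + 4 * B 3) * L)"
    proof (rule mult_left_mono[OF _ net_const_nonneg])
      have "(\<Sum>i<n. d ((r \<circ> y \<circ> s) i) ((r \<circ> y \<circ> s) (Suc i))) \<le>
          (\<Sum>i<n. d (y (s i)) (y (s (Suc i))) + 2)"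
        unfolding o_def by (intro sum_mono dist_r_r yin sl) auto
      also have "\<dots> = (\<Sum>i<n. d (y (s i)) (y (s (Suc i)))) + 2 * real n"
        by (simp add: sum.distrib)
      also have "(\<Sum>i<n. d (y (s i)) (y (s (Suc i)))) \<le> (\<Sum>i=s 0..<s n. d (y i) (y (Suc i)))"
        using s(1,2) yin by (intro subsequence_length_le) auto
      also have "\<dots> \<le> L" unfolding L_def using s(2) by (intro sum_mono2) auto
      also have "L + 2 * real n \<le> (1 + 4 * B 3) * L" using n cR by (simp add: algebra_simps)
      finally show "(\<Sum>i<n. d ((r \<circ> y \<circ> s) i) ((r \<circ> y \<circ> s) (Suc i))) \<le> (1 + 4 * B 3) * L"
        by simp
    qed
    finally have net: "(\<Sum>i<m. d (r (x i)) (r (x (Suc i)))) \<le> net_const * ((1 + 4 * B 3) * L)"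
      by simp
    have "(\<Sum>i | i < m \<and> c (x i) \<noteq> c (x (Suc i)). d (x i) (x (Suc i))) \<le>
      (\<Sum>i | i < m \<and> c (x i) \<noteq> c (x (Suc i)). d (r (x i)) (r (x (Suc i))) + 2)"
      using xin by (intro sum_mono dist_le_r_r) auto
    also have "\<dots> = (\<Sum>i | i < m \<and> c (x i) \<noteq> c (x (Suc i)). d (r (x i)) (r (x (Suc i)))) +
        2 * card {i. i < m \<and> c (x i) \<noteq> c (x (Suc i))}"
      by (simp add: sum.distrib)
    also have "\<dots> \<le> (\<Sum>i<m. d (r (x i)) (r (x (Suc i)))) + 2 * card C"
      using changes by (intro add_mono sum_mono2) auto
    finally have "(\<Sum>i<m. d (x i) (x (Suc i))) \<le> net_const * ((1 + 4 * B 3) * L) + 3 * card C"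
      using inner split net False by simp
    also have "\<dots> \<le> net_const * ((1 + 4 * B 3) * L) + 3 * (2 * D * B 3 * L)"
      using cC by (simp add: mult_ac)
    also have "\<dots> \<le> length_const * L"
    proof -
      have "0 \<le> D * B 3 * L" using L0 by simp
      then show ?thesis by (simp add: length_const_def algebra_simps)
    qed
    finally show ?thesis by (simp add: L_def)
  qed
qed

end

section \<open>The hierarchical order\<close>

lemma ex_strict_linear_order: "\<exists>R :: 'b rel. trans R \<and> irrefl R \<and> total R"
proof -
  obtain R :: "'b rel" where R: "Well_order R" "Field R = UNIV"
    using well_ordering by (elim exE conjE)
  then have "trans R" "antisym R" "total_on UNIV R"
    by (auto simp: order_on_defs)
  then have "trans (R - Id)" "total (R - Id)"
    by (auto simp: total_on_def trans_diff_Id)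
  then show ?thesis by (auto simp: irrefl_def)
qed

definition seq_less :: "'b rel \<Rightarrow> (nat \<Rightarrow> 'b) \<Rightarrow> (nat \<Rightarrow> 'b) \<Rightarrow> bool" where
  "seq_less R f g \<longleftrightarrow> (\<exists>n. (\<forall>k<n. f k = g k) \<and> (f n, g n) \<in> R)"

lemma seq_less_trans:
  assumes "trans R" "seq_less R f g" "seq_less R g k"
  shows "seq_less R f k"
proof -
  obtain m where m: "\<forall>i<m. f i = g i" "(f m, g m) \<in> R" using assms(2) by (auto simp: seq_less_def)
  obtain n where n: "\<forall>i<n. g i = k i" "(g n, k n) \<in> R" using assms(3) by (auto simp: seq_less_def)
  have "(f (min m n), k (min m n)) \<in> R"
    using m n transD[OF assms(1), of "f m" "g m" "k m"]
    by (cases m n rule: linorder_cases) (auto simp: min_def)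
  then show ?thesis using m n unfolding seq_less_def by (intro exI[of _ "min m n"]) auto
qed

lemma seq_less_irrefl: "irrefl R \<Longrightarrow> \<not> seq_less R f f"
  by (auto simp: seq_less_def irrefl_def)

lemma seq_less_total:
  assumes "total R" "f \<noteq> g"
  shows "seq_less R f g \<or> seq_less R g f"
proof -
  obtain n where "f n \<noteq> g n" "\<forall>k<n. f k = g k"
    using exists_least_iff[of "\<lambda>n. f n \<noteq> g n"] assms(2) by auto
  moreover from this have "(f n, g n) \<in> R \<or> (g n, f n) \<in> R"
    using assms(1) by (auto simp: total_on_def)
  ultimately show ?thesis unfolding seq_less_def by metis
qed

text \<open>Suppose that \<open>g\<close> first differs from \<open>f\<close> at a place
  \<open>a\<close> with \<open>a \<le> n\<close>. If it differs from \<open>k\<close> at another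
  place first, then at the earlier of the two places a term of \<open>R\<close> would be below
  itself, since \<open>f\<close> and \<open>k\<close> agree there. If the places coincide,
  transitivity puts \<open>f a\<close> below \<open>k a\<close>, which equals
  \<open>f a\<close>.\<close>

lemma seq_less_between:
  assumes R: "trans R" "irrefl R" and "f = g \<or> seq_less R f g" "g = k \<or> seq_less R g k"
    and eq: "\<And>i. i \<le> n \<Longrightarrow> f i = k i"
  shows "g n = f n"
proof (rule ccontr)
  assume neq: "g n \<noteq> f n"
  obtain a where a: "\<forall>i<a. f i = g i" "(f a, g a) \<in> R"
    using assms(3) neq by (auto simp: seq_less_def)
  then have "a \<le> n" using neq by (metis not_le)
  have "g \<noteq> k" using neq eq by auto
  then obtain b where b: "\<forall>i<b. g i = k i" "(g b, k b) \<in> R"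
    using assms(4) by (auto simp: seq_less_def)
  consider "a < b" | "b < a" | "a = b" by linarith
  then show False
  proof cases
    case 1
    then have "g a = f a" using b eq \<open>a \<le> n\<close> by auto
    then show False using a R(2) by (auto simp: irrefl_def)
  next
    case 2
    then have "g b = k b" using a eq \<open>a \<le> n\<close> by auto
    then show False using b R(2) by (auto simp: irrefl_def)
  next
    case 3
    then have "(f a, f a) \<in> R" using a b eq[of a] \<open>a \<le> n\<close> transD[OF R(1)] by metis
    then show False using R(2) by (auto simp: irrefl_def)
  qed
qed

context hyperbolic_hierarchy
begin

text \<open>The branch from the root to \<open>x\<close>, padded with \<open>None\<close>.
  Descendants of a vertex share an initial segment, so lexicographic comparison of codes keeps them
  together as in a depth-first traversal. The order on the entries is arbitrary, hence a vertex may
  come before, after or among its descendants.\<close>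

definition code :: "'a \<Rightarrow> nat \<Rightarrow> 'a option" where
  "code x n = (if n \<le> h x then Some (anc n x) else None)"

lemma anc_self: "x \<in> M \<Longrightarrow> anc (h x) x = x"
  using dist_anc[of x "h x"] anc_in[of x "h x"] by auto

lemma code_inj:
  assumes "x \<in> M" "y \<in> M" "code x = code y"
  shows "x = y"
proof -
  have *: "n \<le> h x \<longleftrightarrow> n \<le> h y" for n
    using fun_cong[OF assms(3), of n] by (auto simp: code_def split: if_splits)
  have "h x = h y" using *[of "h x"] *[of "h y"] by auto
  then have "anc (h x) x = anc (h y) y"
    using fun_cong[OF assms(3), of "h x"] by (auto simp: code_def)
  then show ?thesis using anc_self assms by simp
qed

text \<open>Points with the same ancestor at level \<open>n\<close> share all ancestors at lower
  levels by \<open>anc_anc\<close>. Their codes therefore agree up to place \<open>n\<close>, and so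
  does any code between them.\<close>

lemma coherent_if_sorted:
  assumes R: "trans R" "irrefl R" and xM: "x ` {..m} \<subseteq> M"
    and sorted: "\<And>i j. i < j \<Longrightarrow> j \<le> m \<Longrightarrow> code (x i) = code (x j) \<or> seq_less R (code (x i)) (code (x j))"
  shows "coherent x m"
  unfolding coherent_def
proof (intro allI impI)
  fix n i j k
  assume ijk: "i < j" "j < k" "k \<le> m" "n \<le> h (x i)" "n \<le> h (x k)" "anc n (x i) = anc n (x k)"
  have "code (x j) n = code (x i) n"
  proof (rule seq_less_between[OF R sorted sorted])
    fix a assume "a \<le> n"
    then have "anc a (x i) = anc a (x k)"
      using anc_anc[of "x i" a n] anc_anc[of "x k" a n] ijk xM by (simp add: image_subset_iff)
    then show "code (x i) a = code (x k) a" using ijk \<open>a \<le> n\<close> by (simp add: code_def)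
  qed (use ijk in auto)
  then show "n \<le> h (x j) \<and> anc n (x j) = anc n (x i)"
    using ijk by (auto simp: code_def split: if_splits)
qed

end

context hierarchical_net
begin

text \<open>The order compares the code of the net point first, then the label \<open>e\<close>,
  then \<open>u\<close>. The first key yields coherence, and the last one monotonicity in each
  cell.\<close>

lemma ex_adapted_order:
  fixes e :: "'a \<Rightarrow> 'e"
  assumes cell_iff: "\<And>p q. p \<in> M \<Longrightarrow> q \<in> M \<Longrightarrow>
      c p = c q \<longleftrightarrow> r p = r q \<and> e p = e q \<and> (u p \<le> 1 / 2 \<longleftrightarrow> u q \<le> 1 / 2)"
    and inj: "\<And>p q. p \<in> M \<Longrightarrow> q \<in> M \<Longrightarrow> r p = r q \<Longrightarrow> e p = e q \<Longrightarrow> u p = u q \<Longrightarrow> p = q"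
  shows "\<exists>T. linear_order_on M T \<and>
    (\<forall>x m. x ` {..m} \<subseteq> M \<longrightarrow> (\<forall>i j. i < j \<longrightarrow> j \<le> m \<longrightarrow> (x i, x j) \<in> T) \<longrightarrow> adapted x m)"
proof -
  obtain W :: "'a option rel" where W: "trans W" "irrefl W" "total W"
    using ex_strict_linear_order by blast
  obtain E :: "'e rel" where E: "trans E" "irrefl E" "total E"
    using ex_strict_linear_order by blast
  define A where "A p q \<longleftrightarrow> seq_less W (net.code (r p)) (net.code (r q))" for p q
  define lt where "lt p q \<longleftrightarrow> A p q \<or> r p = r q \<and> ((e p, e q) \<in> E \<or> e p = e q \<and> u p < u q)" for p q
  define T where "T = {(p, q). p \<in> M \<and> q \<in> M \<and> (p = q \<or> lt p q)}"
  have A_trans: "A p s" if "A p q" "A q s" for p q s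
    using that seq_less_trans[OF W(1)] by (auto simp: A_def)
  have A_irrefl: "\<not> A p q" if "r p = r q" for p q
    using that seq_less_irrefl[OF W(2)] by (auto simp: A_def)
  have A_cong: "A p q \<longleftrightarrow> A p' q'" if "r p = r p'" "r q = r q'" for p q p' q'
    using that by (simp add: A_def)
  have A_total: "A p q \<or> A q p" if "p \<in> M" "q \<in> M" "r p \<noteq> r q" for p q
    using that seq_less_total[OF W(3), of "net.code (r p)" "net.code (r q)"] net.code_inj r_in
    by (auto simp: A_def)
  have E_irrefl: "(z, z) \<notin> E" for z using E(2) by (simp add: irrefl_def)
  have E_trans: "(a, b) \<in> E \<Longrightarrow> (b, z) \<in> E \<Longrightarrow> (a, z) \<in> E" for a b z using E(1) by (rule transD)
  have lt_trans: "lt p s" if "lt p q" "lt q s" for p q s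
    using that A_trans[of p q s] A_cong[of p p q s] A_cong[of q p s s]
      E_trans[of "e p" "e q" "e s"] unfolding lt_def by auto
  have lt_irrefl: "\<not> lt p p" for p
    using A_irrefl[of p p] E_irrefl by (auto simp: lt_def)
  have lt_total: "lt p q \<or> lt q p" if "p \<in> M" "q \<in> M" "p \<noteq> q" for p q
  proof (cases "r p = r q")
    case True
    show ?thesis
    proof (cases "e p = e q")
      case True
      then show ?thesis using inj[OF that(1,2) \<open>r p = r q\<close>] that(3) \<open>r p = r q\<close>
        by (auto simp: lt_def neq_iff)
    next
      case False
      then show ?thesis using E(3) True by (auto simp: lt_def total_on_def)
    qed
  qed (use A_total[OF that(1,2)] in \<open>auto simp: lt_def\<close>)
  have "linear_order_on M T"
    unfolding order_on_defs
  proof (intro conjI)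
    show "T \<subseteq> M \<times> M" "refl_on M T" by (auto simp: T_def refl_on_def)
    show "trans T" using lt_trans by (auto simp: T_def intro!: transI)
    show "antisym T" using lt_trans lt_irrefl by (auto simp: T_def intro!: antisymI)
    show "total_on M T" using lt_total by (auto simp: T_def total_on_def)
  qed
  moreover have "adapted x m" if xM: "x ` {..m} \<subseteq> M"
    and sorted: "\<And>i j. i < j \<Longrightarrow> j \<le> m \<Longrightarrow> (x i, x j) \<in> T" for x m
    unfolding adapted_def
  proof (intro conjI allI impI)
    have le: "x i = x j \<or> lt (x i) (x j)" if "i < j" "j \<le> m" for i j
      using sorted[OF that] by (auto simp: T_def)
    have r_le: "r (x i) = r (x j) \<or> A (x i) (x j)" if "i < j" "j \<le> m" for i j
      using le[OF that] by (auto simp: lt_def)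
    have x_in: "x i \<in> M" if "i \<le> m" for i using xM that by auto
    show "x ` {..m} \<subseteq> M" by (rule xM)
    show "net.coherent (r \<circ> x) m"
    proof (rule net.coherent_if_sorted[OF W(1,2)])
      show "(r \<circ> x) ` {..m} \<subseteq> V" using x_in r_in by auto
      show "net.code ((r \<circ> x) i) = net.code ((r \<circ> x) j) \<or>
          seq_less W (net.code ((r \<circ> x) i)) (net.code ((r \<circ> x) j))" if "i < j" "j \<le> m" for i j
        using r_le[OF that] by (auto simp: A_def)
    qed
    show "u (x i) \<le> u (x j)" if "i < j" "j \<le> m" "c (x i) = c (x j)" for i j
      using le[OF that(1,2)] that(3) cell_iff[of "x i" "x j"] x_in that A_irrefl E_irrefl
      by (auto simp: lt_def)
    show "c (x j) = c (x i)" if ijk: "i < j" "j < k" "k \<le> m" and eq: "c (x i) = c (x k)" for i j k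
    proof -
      have ik: "r (x i) = r (x k)" "e (x i) = e (x k)" "u (x i) \<le> 1 / 2 \<longleftrightarrow> u (x k) \<le> 1 / 2"
        using eq cell_iff[of "x i" "x k"] x_in ijk by auto
      have le1: "x i = x j \<or> lt (x i) (x j)" and le2: "x j = x k \<or> lt (x j) (x k)"
        using le ijk by auto
      have r: "r (x j) = r (x i)"
      proof (rule ccontr)
        assume "r (x j) \<noteq> r (x i)"
        then have "A (x i) (x j)" "A (x j) (x k)"
          using r_le[of i j] r_le[of j k] ijk ik(1) by auto
        then show False using A_trans A_irrefl ik(1) by blast
      qed
      have e: "e (x j) = e (x i)"
      proof (rule ccontr)
        assume "e (x j) \<noteq> e (x i)"
        then have "(e (x i), e (x j)) \<in> E" "(e (x j), e (x k)) \<in> E"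
          using le1 le2 r ik(1,2) A_irrefl by (auto simp: lt_def)
        then show False using E_trans E_irrefl ik(2) by metis
      qed
      \<comment> \<open>Once net point and label agree, the half of the edge is decided by the
        threshold 1/2 of the monotone parameter \<open>u\<close>, so it cannot change in
        between.\<close>
      have "u (x i) \<le> u (x j)" "u (x j) \<le> u (x k)"
        using le1 le2 r e ik A_irrefl E_irrefl by (auto simp: lt_def)
      then have "u (x j) \<le> 1 / 2 \<longleftrightarrow> u (x i) \<le> 1 / 2" using ik(3) by linarith
      then show ?thesis using r e cell_iff[of "x j" "x i"] x_in ijk by auto
    qed
  qed
  ultimately show ?thesis by blast
qed

end

text \<open>Translates from permutations of finite sets to sequences indexed by
  \<open>{..m}\<close>. The maximum with 1 covers the one-point space, where \<open>OR\<close> is 1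
  by definition.\<close>

lemma OR_le:
  fixes d :: "'a \<Rightarrow> 'a \<Rightarrow> real"
  assumes T: "linear_order_on M T" and nonneg: "\<And>x y. 0 \<le> d x y" and "0 \<le> C"
    and le: "\<And>x y m l. x ` {..m} \<subseteq> M \<Longrightarrow> (\<And>i j. i < j \<Longrightarrow> j \<le> m \<Longrightarrow> (x i, x j) \<in> T) \<Longrightarrow>
      x ` {..m} = y ` {..l} \<Longrightarrow>
      (\<Sum>i<m. d (x i) (x (Suc i))) \<le> C * (\<Sum>i<l. d (y i) (y (Suc i)))"
  shows "OR M d T k \<le> ereal (max 1 C)"
proof (cases "is_singleton M")
  case True
  then show ?thesis by (simp add: OR_def one_ereal_def)
next
  case False
  have "ereal (l_ord d T X / l_opt d X) \<le> ereal (max 1 C)"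
    if X: "X \<subseteq> M" "2 \<le> card X" for X
  proof -
    have finX: "finite X" and "X \<noteq> {}" using X(2) by (auto intro: card_ge_0_finite)
    define xs where "xs = order_enum T X"
    have xs: "xs \<in> permutations_of_set X" "sorted_wrt (\<lambda>x y. (x, y) \<in> T) xs"
      using theI'[OF order_enum_unique[OF T finX X(1)]] by (auto simp: xs_def order_enum_def)
    have "l_opt d X \<in> path_length d ` permutations_of_set X"
      unfolding l_opt_def using finX xs(1) by (intro Min_in) auto
    then obtain ys where ys: "ys \<in> permutations_of_set X" "l_opt d X = path_length d ys" by auto
    have set_nth: "(!) zs ` {..length zs - 1} = X" if "zs \<in> permutations_of_set X" for zs
    proof -
      have zs: "set zs = X" "zs \<noteq> []"
        using that \<open>X \<noteq> {}\<close> by (auto simp: permutations_of_set_def)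
      then have "{..length zs - 1} = {..<length zs}" by (cases zs) auto
      then show ?thesis using zs(1) by (auto simp: set_conv_nth)
    qed
    have "l_ord d T X \<le> C * l_opt d X"
      unfolding ys(2) l_ord_def xs_def[symmetric] path_length_def
    proof (rule le)
      show "(!) xs ` {..length xs - 1} \<subseteq> M" using set_nth[OF xs(1)] X(1) by simp
      show "(!) xs ` {..length xs - 1} = (!) ys ` {..length ys - 1}"
        using set_nth xs(1) ys(1) by simp
      show "(xs ! i, xs ! j) \<in> T" if "i < j" "j \<le> length xs - 1" for i j
        using xs(2) that by (auto simp: sorted_wrt_iff_nth_less)
    qed
    moreover have "0 \<le> l_opt d X"
      unfolding ys(2) path_length_def using nonneg by (simp add: sum_nonneg)
    \<comment> \<open>Only nonnegativity of \<open>d\<close> is assumed, so \<open>l_opt d X\<close>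
      might be 0; the quotient is then 0 by convention.\<close>
    ultimately have "l_ord d T X / l_opt d X \<le> C"
      using \<open>0 \<le> C\<close> by (cases "l_opt d X = 0") (auto simp: divide_simps mult.commute)
    then show ?thesis by (simp add: le_max_iff_disj)
  qed
  then show ?thesis using False by (auto simp: OR_def intro!: SUP_least)
qed

section \<open>Distances in a graph\<close>

definition adj :: "('v, 'e) pre_digraph \<Rightarrow> 'v rel" where
  "adj G = {(u, v). \<exists>e\<in>arcs G. (tail G e = u \<and> head G e = v) \<or> (tail G e = v \<and> head G e = u)}"

definition hops :: "('v, 'e) pre_digraph \<Rightarrow> 'v \<Rightarrow> 'v \<Rightarrow> nat" where
  "hops G u v = (LEAST n. (u, v) \<in> adj G ^^ n)"

lemma adj_sym: "(u, v) \<in> adj G \<Longrightarrow> (v, u) \<in> adj G"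
  by (auto simp: adj_def)

lemma graph_dist_le:
  "graph_path G p q l \<Longrightarrow> p \<in> graph_points G \<Longrightarrow> q \<in> graph_points G \<Longrightarrow> graph_dist G p q \<le> l"
  by (auto simp: graph_dist_def intro!: cInf_lower bdd_belowI graph_path_nonneg)

text \<open>The largest of the three sums exceeds the maximum of the other two by at most \<delta>.
  If the sum on the left is not the largest, the bound holds because \<delta> is
  nonnegative.\<close>

lemma hyperbolic_four_point:
  assumes "hyperbolic \<delta> M d" "x \<in> M" "y \<in> M" "z \<in> M" "w \<in> M"
  shows "d x y + d z w \<le> max (d x z + d y w) (d x w + d y z) + \<delta>"
proof -
  have "sort [d x y + d z w, d x z + d y w, d x w + d y z] ! 2 -
      sort [d x y + d z w, d x z + d y w, d x w + d y z] ! 1 \<le> \<delta>" "0 \<le> \<delta>"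
    using assms by (auto simp: hyperbolic_def Let_def)
  then show ?thesis by (auto simp: numeral_2_eq_2 max_def split: if_splits)
qed

context wf_digraph
begin

lemma adj_in: "(u, v) \<in> adj G \<Longrightarrow> u \<in> verts G \<and> v \<in> verts G"
  by (auto simp: adj_def)

lemma graph_path_adj: "(u, v) \<in> adj G \<Longrightarrow> graph_path G (Vertex u) (Vertex v) 1"
  using graph_path_edge[of _ 0 1] graph_path_edge[of _ 1 0]
  by (fastforce simp: adj_def edge_point_def)

lemma graph_path_relpow:
  "(u, v) \<in> adj G ^^ n \<Longrightarrow> u \<in> verts G \<Longrightarrow> graph_path G (Vertex u) (Vertex v) n"
proof (induction n arbitrary: v)
  case 0
  then show ?case by (auto simp: graph_points_def intro: graph_path.refl)
next
  case (Suc n)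
  then obtain w where "(u, w) \<in> adj G ^^ n" "(w, v) \<in> adj G" by auto
  then have "graph_path G (Vertex u) (Vertex v) (real n + 1)"
    using Suc by (intro graph_path_trans[of G _ "Vertex w"] graph_path_adj) auto
  then show ?case by (simp add: add.commute)
qed

lemma card_adj_le:
  assumes "finite (in_arcs G v)" "finite (out_arcs G v)" "in_degree G v + out_degree G v \<le> D"
  shows "finite (adj G `` {v}) \<and> card (adj G `` {v}) \<le> D"
proof -
  have *: "adj G `` {v} = head G ` out_arcs G v \<union> tail G ` in_arcs G v"
    by (auto simp: adj_def)
  have "card (adj G `` {v}) \<le> card (head G ` out_arcs G v) + card (tail G ` in_arcs G v)"
    unfolding * by (rule card_Un_le)
  also have "\<dots> \<le> out_degree G v + in_degree G v"
    unfolding out_degree_def in_degree_def using assms by (intro add_mono card_image_le) auto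
  finally show ?thesis using assms * by auto
qed

context
  assumes conn: "Digraph_Component.connected G"
begin

lemma reach: "u \<in> verts G \<Longrightarrow> v \<in> verts G \<Longrightarrow> \<exists>n. (u, v) \<in> adj G ^^ n"
proof -
  assume "u \<in> verts G" "v \<in> verts G"
  then have "(u, v) \<in> rtrancl_on (verts G) ((arcs_ends G)\<^sup>s)"
    using conn by (simp add: connected_conv)
  then show ?thesis
  proof (induction rule: rtrancl_on_induct)
    case base
    show ?case by (rule exI[of _ 0]) simp
  next
    case (step y z)
    then obtain n where "(u, y) \<in> adj G ^^ n" by auto
    moreover have "(y, z) \<in> adj G"
      using step by (auto simp: symcl_def arcs_ends_conv adj_def)
    ultimately show ?case by (auto intro!: exI[of _ "Suc n"])
  qed
qed

lemma hops_relpow: "u \<in> verts G \<Longrightarrow> v \<in> verts G \<Longrightarrow> (u, v) \<in> adj G ^^ hops G u v"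
  unfolding hops_def using reach by (rule LeastI_ex)

lemma hops_le: "(u, v) \<in> adj G ^^ n \<Longrightarrow> hops G u v \<le> n"
  unfolding hops_def by (rule Least_le)

lemma hops_adj: "u \<in> verts G \<Longrightarrow> (v, w) \<in> adj G \<Longrightarrow> hops G u w \<le> Suc (hops G u v)"
  using hops_relpow[of u v] adj_in[of v w] by (intro hops_le) auto

lemma hops_eq_0: "u \<in> verts G \<Longrightarrow> v \<in> verts G \<Longrightarrow> hops G u v = 0 \<longleftrightarrow> u = v"
  using hops_relpow[of u v] hops_le[of u u 0] by auto

lemma ex_parent:
  assumes "u \<in> verts G" "v \<in> verts G" "0 < hops G u v"
  shows "\<exists>w. (w, v) \<in> adj G \<and> Suc (hops G u w) = hops G u v"
proof -
  obtain n where n: "hops G u v = Suc n" using assms(3) gr0_conv_Suc by blast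
  then obtain w where w: "(u, w) \<in> adj G ^^ n" "(w, v) \<in> adj G"
    using hops_relpow[OF assms(1,2)] by auto
  then have "hops G u w \<le> n" "Suc n \<le> Suc (hops G u w)"
    using hops_le[of u w n] hops_adj[OF assms(1) w(2)] n by auto
  then show ?thesis using w n by auto
qed

text \<open>Lower bounds for the infimum over all paths come from potentials that are 1-Lipschitz
  along each closed edge.\<close>

lemma graph_dist_ge:
  assumes "p \<in> graph_points G" "q \<in> graph_points G"
    and "\<And>e s t. e \<in> arcs G \<Longrightarrow> s \<in> {0..1} \<Longrightarrow> t \<in> {0..1} \<Longrightarrow>
      \<bar>f (edge_point G e s) - f (edge_point G e t)\<bar> \<le> \<bar>s - t\<bar>"
  shows "\<bar>f p - f q\<bar> \<le> graph_dist G p q"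
  using graph_path_exists[OF conn assms(1,2)] graph_path_Lipschitz[of G f, OF assms(3)] assms(1,2)
  by (auto simp: graph_dist_def intro!: cInf_greatest)

text \<open>The potential for the lower bound is the distance from \<open>u\<close>, extended into
  each edge by the shorter of the two routes through its ends.\<close>

lemma graph_dist_vertices:
  assumes u: "u \<in> verts G" and v: "v \<in> verts G"
  shows "graph_dist G (Vertex u) (Vertex v) = hops G u v"
proof (rule antisym)
  show "graph_dist G (Vertex u) (Vertex v) \<le> hops G u v"
    using u v by (intro graph_dist_le graph_path_relpow hops_relpow) (auto simp: graph_points_def)
  define f :: "('a, 'b) graph_point \<Rightarrow> real" where
    "f x = (case x of Vertex w \<Rightarrow> real (hops G u w)
      | Inner e t \<Rightarrow> min (hops G u (tail G e) + t) (hops G u (head G e) + (1 - t)))" for x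
  have "\<bar>f (Vertex u) - f (Vertex v)\<bar> \<le> graph_dist G (Vertex u) (Vertex v)"
  proof (rule graph_dist_ge)
    fix e s t assume e: "e \<in> arcs G" and st: "s \<in> {0..1::real}" "t \<in> {0..1::real}"
    have "(tail G e, head G e) \<in> adj G" "(head G e, tail G e) \<in> adj G"
      using e by (auto simp: adj_def)
    from this[THEN hops_adj[OF u]]
    have "real (hops G u (head G e)) \<le> real (hops G u (tail G e)) + 1"
      "real (hops G u (tail G e)) \<le> real (hops G u (head G e)) + 1" by auto
    \<comment> \<open>The formula for inner points persists at the ends \<open>s = 0\<close> and
      \<open>s = 1\<close>, because \<open>hops\<close> differs by at most 1 between the ends of an
      edge.\<close>
    then have "f (edge_point G e s) =
        min (real (hops G u (tail G e)) + s) (real (hops G u (head G e)) + (1 - s))"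
      if "s \<in> {0..1}" for s :: real
      using that by (auto simp: f_def edge_point_def)
    from this[OF st(1)] this[OF st(2)]
    show "\<bar>f (edge_point G e s) - f (edge_point G e t)\<bar> \<le> \<bar>s - t\<bar>"
      by (auto simp: min_def abs_if)
  qed (use u v in \<open>auto simp: graph_points_def\<close>)
  moreover have "f (Vertex u) = 0" using hops_eq_0[OF u u] by (simp add: f_def)
  ultimately show "hops G u v \<le> graph_dist G (Vertex u) (Vertex v)" by (simp add: f_def)
qed

text \<open>The potential \<open>min t (1 - t)\<close> vanishes at every vertex, hence is defined on
  the whole graph, and it has slope 1 or -1 on each half of an edge.\<close>

lemma graph_dist_half_edge:
  assumes "e \<in> arcs G" "0 < s" "s < 1" "0 < t" "t < 1" "s \<le> 1 / 2 \<longleftrightarrow> t \<le> 1 / 2"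
  shows "graph_dist G (Inner e s) (Inner e t) = \<bar>s - t\<bar>"
proof (rule antisym)
  have in_points: "Inner e s \<in> graph_points G" "Inner e t \<in> graph_points G"
    using assms by (auto simp: graph_points_def)
  show "graph_dist G (Inner e s) (Inner e t) \<le> \<bar>s - t\<bar>"
    using graph_path_edge[of e s t] assms in_points
    by (intro graph_dist_le) (auto simp: edge_point_def)
  define f :: "('a, 'b) graph_point \<Rightarrow> real" where
    "f x = (case x of Vertex w \<Rightarrow> 0 | Inner e t \<Rightarrow> min t (1 - t))" for x
  have "\<bar>f (Inner e s) - f (Inner e t)\<bar> \<le> graph_dist G (Inner e s) (Inner e t)"
    by (rule graph_dist_ge) (use in_points in \<open>auto simp: f_def edge_point_def\<close>)
  moreover have "\<bar>f (Inner e s) - f (Inner e t)\<bar> = \<bar>s - t\<bar>"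
    using assms(6) by (auto simp: f_def min_def)
  ultimately show "\<bar>s - t\<bar> \<le> graph_dist G (Inner e s) (Inner e t)" by simp
qed

lemma card_hops_ball_le:
  assumes "u \<in> verts G" and deg: "\<And>v. v \<in> verts G \<Longrightarrow> finite (adj G `` {v}) \<and> card (adj G `` {v}) \<le> D"
  shows "finite {v \<in> verts G. hops G u v \<le> n} \<and> card {v \<in> verts G. hops G u v \<le> n} \<le> Suc D ^ n"
proof (induction n)
  case 0
  have "{v \<in> verts G. hops G u v \<le> 0} = {u}" using hops_eq_0 assms(1) by auto
  then show ?case by simp
next
  case (Suc n)
  have card_insert: "card (insert w (adj G `` {w})) \<le> Suc D" if "w \<in> verts G" for w
    using deg[OF that] by (simp add: card_insert_if)
  let ?B = "\<lambda>n. {v \<in> verts G. hops G u v \<le> n}"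
  have "?B (Suc n) \<subseteq> (\<Union>w\<in>?B n. insert w (adj G `` {w}))"
  proof
    fix v assume v: "v \<in> ?B (Suc n)"
    show "v \<in> (\<Union>w\<in>?B n. insert w (adj G `` {w}))"
    proof (cases "hops G u v \<le> n")
      case False
      then obtain w where "(w, v) \<in> adj G" "Suc (hops G u w) = hops G u v"
        using ex_parent[OF assms(1), of v] v by auto
      then show ?thesis using v adj_in by fastforce
    qed (use v in auto)
  qed
  moreover have fin: "finite (\<Union>w\<in>?B n. insert w (adj G `` {w}))"
    using Suc deg by auto
  ultimately have "finite (?B (Suc n))" and
    "card (?B (Suc n)) \<le> card (\<Union>w\<in>?B n. insert w (adj G `` {w}))"
    by (auto intro: finite_subset card_mono)
  note this(2)
  also have "\<dots> \<le> (\<Sum>w\<in>?B n. card (insert w (adj G `` {w})))"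
    using Suc by (intro card_UN_le) auto
  also have "\<dots> \<le> card (?B n) * Suc D"
    using card_insert sum_bounded_above[of "?B n" "\<lambda>w. card (insert w (adj G `` {w}))" "Suc D"]
    by auto
  also have "\<dots> \<le> Suc D ^ n * Suc D" using Suc by (intro mult_right_mono) auto
  finally show ?case using \<open>finite (?B (Suc n))\<close> by (simp add: mult.commute)
qed

end

end

section \<open>The breadth-first search tree of a graph\<close>

definition bfs_parent :: "('v, 'e) pre_digraph \<Rightarrow> 'v \<Rightarrow> 'v \<Rightarrow> 'v" where
  "bfs_parent G v0 v = (SOME w. (w, v) \<in> adj G \<and> Suc (hops G v0 w) = hops G v0 v)"

text \<open>The hierarchy lives on the vertices; the value at inner points is junk, as it is for
  \<open>ancestor\<close>.\<close>

definition level :: "('v, 'e) pre_digraph \<Rightarrow> 'v \<Rightarrow> ('v, 'e) graph_point \<Rightarrow> nat" where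
  "level G v0 p = (case p of Vertex v \<Rightarrow> hops G v0 v | Inner e t \<Rightarrow> 0)"

definition ancestor ::
  "('v, 'e) pre_digraph \<Rightarrow> 'v \<Rightarrow> nat \<Rightarrow> ('v, 'e) graph_point \<Rightarrow> ('v, 'e) graph_point" where
  "ancestor G v0 n p =
    (case p of Vertex v \<Rightarrow> Vertex ((bfs_parent G v0 ^^ (hops G v0 v - n)) v) | Inner e t \<Rightarrow> p)"

text \<open>The tail is a fixed choice of end, so that each open edge lies over a single vertex; its
  points are at distance less than 1 from it.\<close>

definition base_vertex :: "('v, 'e) pre_digraph \<Rightarrow> ('v, 'e) graph_point \<Rightarrow> ('v, 'e) graph_point" where
  "base_vertex G p = (case p of Vertex v \<Rightarrow> p | Inner e t \<Rightarrow> Vertex (tail G e))"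

definition edge_label :: "('v, 'e) graph_point \<Rightarrow> 'e option" where
  "edge_label p = (case p of Vertex v \<Rightarrow> None | Inner e t \<Rightarrow> Some e)"

definition parameter :: "('v, 'e) graph_point \<Rightarrow> real" where
  "parameter p = (case p of Vertex v \<Rightarrow> 0 | Inner e t \<Rightarrow> t)"

text \<open>The two halves of an edge are separate cells because the distance of two points of an edge
  can be shorter than their distance along this edge, for instance on a loop.\<close>

definition cell ::
  "('v, 'e) pre_digraph \<Rightarrow> ('v, 'e) graph_point \<Rightarrow> ('v, 'e) graph_point \<times> 'e option \<times> bool" where
  "cell G p = (base_vertex G p, edge_label p, parameter p \<le> 1 / 2)"

context wf_digraph
begin

context
  fixes v0
  assumes conn: "Digraph_Component.connected G" and v0: "v0 \<in> verts G"
begin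

interpretation Metric_space "graph_points G" "graph_dist G"
  using conn by (rule Metric_space_graph)

lemma bfs_parent:
  assumes "v \<in> verts G" "0 < hops G v0 v"
  shows "(bfs_parent G v0 v, v) \<in> adj G" "Suc (hops G v0 (bfs_parent G v0 v)) = hops G v0 v"
  using someI_ex[OF ex_parent[OF conn v0 assms]] by (auto simp: bfs_parent_def)

lemma bfs_parent_funpow:
  "v \<in> verts G \<Longrightarrow> n \<le> hops G v0 v \<Longrightarrow> (bfs_parent G v0 ^^ n) v \<in> verts G \<and>
    hops G v0 ((bfs_parent G v0 ^^ n) v) = hops G v0 v - n \<and> (v, (bfs_parent G v0 ^^ n) v) \<in> adj G ^^ n"
proof (induction n)
  case (Suc n)
  let ?w = "(bfs_parent G v0 ^^ n) v"
  have w: "?w \<in> verts G" "hops G v0 ?w = hops G v0 v - n" "(v, ?w) \<in> adj G ^^ n"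
    using Suc by auto
  then have "(bfs_parent G v0 ?w, ?w) \<in> adj G" "Suc (hops G v0 (bfs_parent G v0 ?w)) = hops G v0 ?w"
    using Suc.prems bfs_parent[of ?w] by auto
  then show ?case using w adj_sym adj_in by (auto intro!: relcompI)
qed simp

text \<open>The four-point inequality is used with \<open>Vertex v0\<close> as one of the points.
  Branches of the tree are geodesic: the chain of parents bounds the distance to an ancestor from
  above, and the triangle inequality from the root bounds it from below.\<close>

lemma hyperbolic_hierarchy_graph:
  assumes hyp: "hyperbolic \<delta> (graph_points G) (graph_dist G)"
  shows "hyperbolic_hierarchy (Vertex ` verts G) (graph_dist G) (level G v0) (ancestor G v0) \<delta>"
proof -
  have sub: "Vertex ` verts G \<subseteq> graph_points G" by (auto simp: graph_points_def)
  then have vin: "Vertex v \<in> graph_points G" if "v \<in> verts G" for v using that by auto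
  have level: "real (level G v0 p) = graph_dist G (Vertex v0) p" if "p \<in> Vertex ` verts G" for p
    using that graph_dist_vertices[OF conn v0] by (auto simp: level_def)
  interpret V: Metric_space "Vertex ` verts G" "graph_dist G"
    using sub by (rule subspace)
  have v0_in: "Vertex v0 \<in> graph_points G" using v0 vin by simp
  show ?thesis
  proof
    show "0 \<le> \<delta>" using hyp by (simp add: hyperbolic_def)
  next
    fix x y z :: "('a, 'b) graph_point"
    assume *: "x \<in> Vertex ` verts G" "y \<in> Vertex ` verts G" "z \<in> Vertex ` verts G"
    then have "x \<in> graph_points G" "y \<in> graph_points G" "z \<in> graph_points G" using sub by auto
    then have "graph_dist G x z + graph_dist G (Vertex v0) y \<le>
        max (graph_dist G x (Vertex v0) + graph_dist G z y) (graph_dist G x y + graph_dist G z (Vertex v0)) + \<delta>"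
      by (intro hyperbolic_four_point[OF hyp] v0_in)
    then show "graph_dist G x z + real (level G v0 y) \<le>
        max (graph_dist G x y + real (level G v0 z)) (graph_dist G y z + real (level G v0 x)) + \<delta>"
      using * by (simp add: level commute max.commute add.commute)
  next
    fix x y :: "('a, 'b) graph_point"
    assume xy: "x \<in> Vertex ` verts G" "y \<in> Vertex ` verts G"
    then have xy': "x \<in> graph_points G" "y \<in> graph_points G" using sub by auto
    show "\<bar>real (level G v0 x) - real (level G v0 y)\<bar> \<le> graph_dist G x y"
      using triangle[OF v0_in xy'] triangle[OF v0_in xy'(2,1)] commute[of y x] xy by (simp add: level)
    show "graph_dist G x y \<le> real (level G v0 x) + real (level G v0 y)"
      using triangle[OF xy'(1) v0_in xy'(2)] commute[of x] xy by (simp add: level)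
    assume "x \<noteq> y"
    then show "1 \<le> graph_dist G x y"
      using xy hops_eq_0[OF conn] by (auto simp: graph_dist_vertices[OF conn] Suc_le_eq)
  next
    fix x :: "('a, 'b) graph_point" and n
    assume "x \<in> Vertex ` verts G" and n: "n \<le> level G v0 x"
    then obtain v where v: "v \<in> verts G" "x = Vertex v" by auto
    let ?w = "(bfs_parent G v0 ^^ (hops G v0 v - n)) v"
    have w: "?w \<in> verts G" "hops G v0 ?w = n" "(v, ?w) \<in> adj G ^^ (hops G v0 v - n)"
      using bfs_parent_funpow[OF v(1), of "hops G v0 v - n"] n v(2) by (auto simp: level_def)
    show "ancestor G v0 n x \<in> Vertex ` verts G" "level G v0 (ancestor G v0 n x) = n"
      using v(2) w by (auto simp: ancestor_def level_def)
    have "graph_dist G x (ancestor G v0 n x) \<le> real (hops G v0 v - n)"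
      using v w hops_le[OF conn w(3)] by (auto simp: ancestor_def graph_dist_vertices[OF conn])
    moreover have "graph_dist G (Vertex v0) x \<le> graph_dist G (Vertex v0) (Vertex ?w) + graph_dist G x (Vertex ?w)"
      using v w vin v0 triangle[of "Vertex v0" "Vertex ?w" x] commute[of x "Vertex ?w"] by auto
    ultimately show "graph_dist G x (ancestor G v0 n x) = real (level G v0 x) - real n"
      using v w n v0 by (simp add: ancestor_def graph_dist_vertices[OF conn] level_def of_nat_diff)
  next
    fix x :: "('a, 'b) graph_point" and k n
    assume "x \<in> Vertex ` verts G" and kn: "k \<le> n" "n \<le> level G v0 x"
    then obtain v where v: "v \<in> verts G" "x = Vertex v" by auto
    have n: "n \<le> hops G v0 v" using kn v by (simp add: level_def)
    have "hops G v0 ((bfs_parent G v0 ^^ (hops G v0 v - n)) v) = n"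
      using bfs_parent_funpow[OF v(1), of "hops G v0 v - n"] n by simp
    moreover have "hops G v0 v - k = (n - k) + (hops G v0 v - n)" using kn n by simp
    ultimately show "ancestor G v0 k (ancestor G v0 n x) = ancestor G v0 k x"
      using v by (simp add: ancestor_def funpow_add)
  qed
qed

lemma hierarchical_net_graph:
  assumes hyp: "hyperbolic \<delta> (graph_points G) (graph_dist G)"
    and deg: "\<And>v. v \<in> verts G \<Longrightarrow>
      finite (in_arcs G v) \<and> finite (out_arcs G v) \<and> in_degree G v + out_degree G v \<le> D"
  shows "hierarchical_net (graph_points G) (graph_dist G) (Vertex ` verts G) (level G v0)
    (ancestor G v0) \<delta> (base_vertex G) (cell G) parameter (\<lambda>K. Suc D ^ nat \<lfloor>K\<rfloor>) (Suc (D * 2))"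
proof -
  interpret net: hyperbolic_hierarchy "Vertex ` verts G" "graph_dist G" "level G v0" "ancestor G v0" \<delta>
    using hyp by (rule hyperbolic_hierarchy_graph)
  have points: "(\<exists>v\<in>verts G. p = Vertex v) \<or> (\<exists>e\<in>arcs G. \<exists>t. 0 < t \<and> t < 1 \<and> p = Inner e t)"
    if "p \<in> graph_points G" for p
    using that by (auto simp: graph_points_def)
  show ?thesis
  proof
    show "Vertex ` verts G \<subseteq> graph_points G" by (auto simp: graph_points_def)
  next
    fix p assume p: "p \<in> graph_points G"
    show "base_vertex G p \<in> Vertex ` verts G"
      using points[OF p] by (auto simp: base_vertex_def)
    show "0 \<le> parameter p \<and> parameter p \<le> 1"
      using points[OF p] by (auto simp: parameter_def)
    show "graph_dist G p (base_vertex G p) \<le> 1"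
    proof (cases p)
      case (Vertex v)
      then show ?thesis using p by (simp add: base_vertex_def)
    next
      case (Inner e t)
      then have et: "e \<in> arcs G" "0 < t" "t < 1" using p by (auto simp: graph_points_def)
      then have "graph_path G p (Vertex (tail G e)) t"
        using graph_path_edge[of e t 0] Inner by (simp add: edge_point_def)
      then have "graph_dist G p (Vertex (tail G e)) \<le> t"
        using p et by (intro graph_dist_le) (auto simp: graph_points_def)
      then show ?thesis using Inner et by (simp add: base_vertex_def)
    qed
  next
    fix x :: "('a, 'b) graph_point" and K :: real
    assume "x \<in> Vertex ` verts G"
    then obtain v where v: "v \<in> verts G" "x = Vertex v" by auto
    let ?B = "{w \<in> verts G. hops G v w \<le> nat \<lfloor>K\<rfloor>}"
    have B: "finite ?B \<and> card ?B \<le> Suc D ^ nat \<lfloor>K\<rfloor>"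
      by (intro card_hops_ball_le[OF conn v(1)] card_adj_le) (use deg in auto)
    \<comment> \<open>Distances between vertices are integers, so the radius may be rounded
      down.\<close>
    have sub: "{y \<in> Vertex ` verts G. graph_dist G x y \<le> K} \<subseteq> Vertex ` ?B"
      using v by (auto simp: graph_dist_vertices[OF conn] le_nat_floor)
    then have "card {y \<in> Vertex ` verts G. graph_dist G x y \<le> K} \<le> card (Vertex ` ?B :: ('a, 'b) graph_point set)"
      using B by (intro card_mono) auto
    also have "\<dots> \<le> card ?B" using B by (intro card_image_le) auto
    finally show "finite {y \<in> Vertex ` verts G. graph_dist G x y \<le> K} \<and>
        card {y \<in> Vertex ` verts G. graph_dist G x y \<le> K} \<le> Suc D ^ nat \<lfloor>K\<rfloor>"
      using B sub finite_subset by (metis (no_types, lifting) finite_imageI le_trans)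
  next
    fix x :: "('a, 'b) graph_point"
    assume "x \<in> Vertex ` verts G"
    then obtain v where v: "v \<in> verts G" "x = Vertex v" by auto
    \<comment> \<open>The vertex itself has parameter 0 and hence the flag \<open>True\<close>; each
      outgoing arc contributes its two halves.\<close>
    let ?C = "insert (x, None, True) ((\<lambda>(e, b). (x, Some e, b)) ` (out_arcs G v \<times> (UNIV :: bool set)))"
    have fin: "finite (out_arcs G v)" "card (out_arcs G v) \<le> D"
      using deg[OF v(1)] by (auto simp: out_degree_def)
    have sub: "cell G ` {p \<in> graph_points G. base_vertex G p = x} \<subseteq> ?C"
      using v points by (force simp: cell_def base_vertex_def edge_label_def parameter_def)
    have "card ?C \<le> Suc (card ((\<lambda>(e, b). (x, Some e, b)) ` (out_arcs G v \<times> (UNIV :: bool set))))"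
      by (rule card_insert_le_m1) auto
    also have "\<dots> \<le> Suc (card (out_arcs G v \<times> (UNIV :: bool set)))"
      using fin by (intro Suc_le_mono[THEN iffD2] card_image_le) auto
    also have "\<dots> \<le> Suc (D * 2)" using fin by (simp add: card_cartesian_product)
    finally show "finite (cell G ` {p \<in> graph_points G. base_vertex G p = x}) \<and>
        card (cell G ` {p \<in> graph_points G. base_vertex G p = x}) \<le> Suc (D * 2)"
      using sub fin card_mono[OF _ sub] finite_subset[OF sub] by auto
  next
    fix p q :: "('a, 'b) graph_point"
    assume p: "p \<in> graph_points G" and q: "q \<in> graph_points G" and "cell G p = cell G q"
    then show "graph_dist G p q = \<bar>parameter p - parameter q\<bar>"
      using points[OF p] points[OF q]
      by (auto simp: cell_def base_vertex_def edge_label_def parameter_def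
          intro!: graph_dist_half_edge[OF conn])
  qed
qed

end

end

theorem theoremB:
  fixes G :: "('v, 'e) pre_digraph" and \<delta> :: real
  assumes "wf_digraph G"
    and "Digraph_Component.connected G"
    and "bounded_degree G"
    and "hyperbolic \<delta> (graph_points G) (graph_dist G)"
  shows "\<exists>T C. linear_order_on (graph_points G) T \<and>
           (\<forall>k\<ge>1. OR (graph_points G) (graph_dist G) T k \<le> ereal C)"
proof -
  interpret wf_digraph G by fact
  obtain v0 where v0: "v0 \<in> verts G"
    using assms(2) by (auto simp: Digraph_Component.connected_def strongly_connected_def)
  obtain D where D: "\<And>v. v \<in> verts G \<Longrightarrow>
      finite (in_arcs G v) \<and> finite (out_arcs G v) \<and> in_degree G v + out_degree G v \<le> D"
    using assms(3) by (auto simp: bounded_degree_def)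
  interpret net: hierarchical_net "graph_points G" "graph_dist G" "Vertex ` verts G" "level G v0"
    "ancestor G v0" \<delta> "base_vertex G" "cell G" parameter "\<lambda>K. Suc D ^ nat \<lfloor>K\<rfloor>" "Suc (D * 2)"
    using assms(2) v0 assms(4) D by (rule hierarchical_net_graph)
  have "\<exists>T. linear_order_on (graph_points G) T \<and>
    (\<forall>x m. x ` {..m} \<subseteq> graph_points G \<longrightarrow>
      (\<forall>i j. i < j \<longrightarrow> j \<le> m \<longrightarrow> (x i, x j) \<in> T) \<longrightarrow> net.adapted x m)"
  proof (rule net.ex_adapted_order)
    show "cell G p = cell G q \<longleftrightarrow> base_vertex G p = base_vertex G q \<and> edge_label p = edge_label q \<and>
      (parameter p \<le> 1 / 2 \<longleftrightarrow> parameter q \<le> 1 / 2)" for p q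
      by (auto simp: cell_def)
    show "p = q" if "base_vertex G p = base_vertex G q" "edge_label p = edge_label q"
      "parameter p = parameter q" for p q
      using that by (cases p; cases q) (auto simp: base_vertex_def edge_label_def parameter_def)
  qed
  then obtain T where T: "linear_order_on (graph_points G) T"
    and adapted: "\<And>x m. x ` {..m} \<subseteq> graph_points G \<Longrightarrow>
      (\<And>i j. i < j \<Longrightarrow> j \<le> m \<Longrightarrow> (x i, x j) \<in> T) \<Longrightarrow> net.adapted x m"
    by blast
  have "0 \<le> net.length_const"
    using net.net_const_nonneg by (simp add: net.length_const_def)
  then have "OR (graph_points G) (graph_dist G) T k \<le> ereal (max 1 net.length_const)" for k
    using T net.nonneg net.adapted_length_le adapted by (intro OR_le) auto
  with T show ?thesis by blast
qed

end
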